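(* Let $G$ be a reduced abelian group with $\aleph_0 \leq |G| < 2^{\aleph_0}$. If $\mathfrak{p} > |G|$ and there is a prime $p$ such that $\mathrm{Tor}_p(G)$ is infinite, then $G$ is not co-Hopfian. In particular, there are no infinite reduced co-Hopfian abelian $p$-groups $G$ (for $p$ a prime) of size $\aleph_0 \leq |G| < \mathfrak{p}$.
   Context: A group $G$ is co-Hopfian if every injective endomorphism of $G$ is surjective. An abelian group is reduced if its only divisible subgroup is $\{0\}$. For a prime $p$, $\mathrm{Tor}_p(G)$ denotes the $p$-torsion subgroup of $G$, i.e. the subgroup of all elements whose order is a power of $p$. The cardinal $\mathfrak{p}$ (a cardinal invariant of the continuum, not to be confused with the prime $p$) is the minimum size of a family $\mathcal{F}$ of infinite subsets of $\omega$ such that: (i) every non-empty finite subfamily of $\mathcal{F}$ has infinite intersection; (ii) there is no infinite $A \subseteq \omega$ such that, for every $B \in \mathcal{F}$, the set $\{x \in A : x \notin B\}$ is finite. *)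

theory Defs
  imports "HOL-Algebra.Algebra"
begin

unbundle cardinal_syntax

section \<open>Abelian groups\<close>

text \<open>Groups are written multiplicatively, as in HOL-Algebra; \<open>y [^] n\<close> is the
  multiple \<open>n y\<close> of additive notation.\<close>

definition divisible_subgroup :: "'a set \<Rightarrow> ('a, 'b) monoid_scheme \<Rightarrow> bool" where
  "divisible_subgroup D G \<longleftrightarrow>
     subgroup D G \<and> (\<forall>n::nat. n > 0 \<longrightarrow> (\<forall>x\<in>D. \<exists>y\<in>D. y [^]\<^bsub>G\<^esub> n = x))"

definition reduced_group :: "('a, 'b) monoid_scheme \<Rightarrow> bool" where
  "reduced_group G \<longleftrightarrow> (\<forall>D. divisible_subgroup D G \<longrightarrow> D = {\<one>\<^bsub>G\<^esub>})"

definition co_Hopfian :: "('a, 'b) monoid_scheme \<Rightarrow> bool" where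
  "co_Hopfian G \<longleftrightarrow> (\<forall>f \<in> mon G G. f ` carrier G = carrier G)"

text \<open>\<^const>\<open>group.ord\<close> is \<open>0\<close> on elements of infinite order, so these are excluded
  for prime \<open>p\<close>.\<close>

definition Tor :: "nat \<Rightarrow> ('a, 'b) monoid_scheme \<Rightarrow> 'a set" where
  "Tor p G = {x \<in> carrier G. \<exists>k::nat. group.ord G x = p ^ k}"

definition p_group :: "nat \<Rightarrow> ('a, 'b) monoid_scheme \<Rightarrow> bool" where
  "p_group p G \<longleftrightarrow> group G \<and> (\<forall>x \<in> carrier G. \<exists>k::nat. group.ord G x = p ^ k)"


section \<open>The pseudointersection number\<close>

definition no_pseudointersection_family :: "nat set set \<Rightarrow> bool" where
  "no_pseudointersection_family \<F> \<longleftrightarrow>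
     (\<forall>B\<in>\<F>. infinite B) \<and>
     (\<forall>\<E>. \<E> \<subseteq> \<F> \<and> finite \<E> \<and> \<E> \<noteq> {} \<longrightarrow> infinite (\<Inter>\<E>)) \<and>
     \<not> (\<exists>A. infinite A \<and> (\<forall>B\<in>\<F>. finite {x \<in> A. x \<notin> B}))"

text \<open>A cardinal is represented by a well-order, so the minimum size is the cardinal
  \<open>|\<F>|\<close> of a chosen family of least size. Such a family exists, see
  \<open>ex_min_no_pseudointersection_family\<close> below.\<close>

definition min_no_pseudointersection_family :: "nat set set \<Rightarrow> bool" where
  "min_no_pseudointersection_family \<F> \<longleftrightarrow>
     no_pseudointersection_family \<F> \<and>
     (\<forall>\<F>'. no_pseudointersection_family \<F>' \<longrightarrow> |\<F>| \<le>o |\<F>'| )"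

definition pseudointersection_number :: "nat set rel" where
  "pseudointersection_number = |SOME \<F>. min_no_pseudointersection_family \<F>|"

lemma ex_no_pseudointersection_family: "\<exists>\<F>. no_pseudointersection_family \<F>"
proof -
  define P :: "nat set set set" where
    "P = {\<F>. \<forall>\<E>. \<E> \<subseteq> \<F> \<and> finite \<E> \<longrightarrow> infinite (\<Inter>\<E>)}"
  have "\<exists>M\<in>P. \<forall>N\<in>P. M \<subseteq> N \<longrightarrow> N = M"
  proof (rule subset_Zorn_nonempty)
    have "{} \<in> P" by (auto simp: P_def)
    then show "P \<noteq> {}" by blast
  next
    fix \<C> assume ne: "\<C> \<noteq> {}" and ch: "subset.chain P \<C>"
    show "\<Union>\<C> \<in> P"
      unfolding P_def
    proof (intro CollectI allI impI)
      fix \<E> assume E: "\<E> \<subseteq> \<Union>\<C> \<and> finite \<E>"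
      then obtain Y where "Y \<in> \<C>" "\<E> \<subseteq> Y"
        using finite_subset_Union_chain[OF _ _ ne ch] by blast
      then show "infinite (\<Inter>\<E>)"
        using E ch by (auto simp: P_def subset.chain_def)
    qed
  qed
  then obtain M where M: "M \<in> P" and max: "\<And>N. N \<in> P \<Longrightarrow> M \<subseteq> N \<Longrightarrow> N = M"
    by blast
  have mem: "S \<in> M" if S: "infinite S" and fin: "\<And>B. B \<in> M \<Longrightarrow> finite (S - B)" for S
  proof -
    have "insert S M \<in> P"
      unfolding P_def
    proof (intro CollectI allI impI)
      fix \<E> assume E: "\<E> \<subseteq> insert S M \<and> finite \<E>"
      have "finite (S - B)" if "B \<in> \<E>" for B
        using that E fin by (cases "B = S") auto
      with E have "finite (\<Union>B\<in>\<E>. S - B)" by blast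
      moreover have "S \<subseteq> (\<Union>B\<in>\<E>. S - B) \<union> \<Inter>\<E>" by blast
      ultimately show "infinite (\<Inter>\<E>)" using S by (meson finite_UnI finite_subset)
    qed
    then show ?thesis using max by blast
  qed
  have "\<not> (\<exists>A. infinite A \<and> (\<forall>B\<in>M. finite {x \<in> A. x \<notin> B}))"
  proof
    assume "\<exists>A. infinite A \<and> (\<forall>B\<in>M. finite {x \<in> A. x \<notin> B})"
    then obtain A where A: "infinite A" and fin: "\<And>B. B \<in> M \<Longrightarrow> finite (A - B)"
      by (auto simp: set_diff_eq)
    obtain S T where ST: "S \<subseteq> A" "T \<subseteq> A" "infinite S" "infinite T" "S \<inter> T = {}"
      using infinite_split[OF A] by metis
    have sub: "finite (U - B)" if "U \<subseteq> A" "B \<in> M" for U B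
      by (rule finite_subset[OF _ fin[OF that(2)]]) (use that(1) in blast)
    have "S \<in> M" by (rule mem[OF ST(3) sub[OF ST(1)]])
    moreover have "T \<in> M" by (rule mem[OF ST(4) sub[OF ST(2)]])
    ultimately have "{S, T} \<subseteq> M \<and> finite {S, T}" by simp
    then have "infinite (\<Inter>{S, T})" using M unfolding P_def by blast
    then show False using ST(5) by simp
  qed
  moreover have "infinite B" if "B \<in> M" for B
  proof -
    have "{B} \<subseteq> M \<and> finite {B}" using that by simp
    then have "infinite (\<Inter>{B})" using M unfolding P_def by blast
    then show ?thesis by simp
  qed
  ultimately have "no_pseudointersection_family M"
    using M unfolding no_pseudointersection_family_def P_def by blast
  then show ?thesis ..
qed

lemma ex_min_no_pseudointersection_family: "\<exists>\<F>. min_no_pseudointersection_family \<F>"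
proof -
  let ?R = "card_of ` Collect no_pseudointersection_family"
  have "?R \<noteq> {}" using ex_no_pseudointersection_family by blast
  moreover have "\<forall>r\<in>?R. Well_order r" by auto
  ultimately have "\<exists>r\<in>?R. \<forall>r'\<in>?R. r \<le>o r'" by (rule exists_minim_Well_order)
  then show ?thesis by (simp add: min_no_pseudointersection_family_def)
qed

end

theory Submission
  imports Defs
begin

text \<open>Let \<open>S\<close> be the \<open>p\<close>-socle of \<open>G\<close>. Since \<open>Tor\<^sub>p(G)\<close> is infinite and reduced, characters of
  \<open>G\<close> of \<open>p\<close>-power order induce infinitely many functionals on \<open>S\<close>. Imposing that a character
  vanish at finitely many elements of \<open>G\<close> keeps this infinite, because of two \<open>p\<close>-power roots of
  unity one is always a power of the other. A countable family of characters therefore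
  carries a filter base of size \<open>|G|\<close>, and a pseudointersection is an infinite set of characters
  that is point-finite on \<open>G\<close>. Thinning it out gives characters \<open>\<xi>\<^sub>k\<close> and socle elements \<open>t\<^sub>k\<close> with
  \<open>\<xi>\<^sub>j t\<^sub>k\<close> nontrivial exactly for \<open>j = k + 1\<close>, and the point-finite sum
  \<open>1 + \<Sum>\<^sub>k t\<^sub>k \<xi>\<^sub>k\<close> makes sense on \<open>G\<close> as soon as \<open>t\<^sub>k\<close> is divisible enough to absorb the
  values of \<open>\<xi>\<^sub>k\<close>. It is injective and misses \<open>t\<^sub>0\<close>.\<close>

section \<open>Roots of unity\<close>

lemma power_gcd_eq_one:
  fixes z :: complex
  assumes "z ^ m = 1" "z ^ n = 1"
  shows "z ^ gcd m n = 1"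
proof (cases "m = 0")
  case True
  then show ?thesis using assms by simp
next
  case False
  then obtain x y where "m * x = n * y + gcd m n" using bezout_nat by blast
  then have "z ^ (m * x) = z ^ (n * y) * z ^ gcd m n" by (simp add: power_add)
  then show ?thesis using assms by (simp add: power_mult)
qed

text \<open>By minimality \<open>p ^ e\<close> is the exact order of \<open>z\<close>, so the powers
  of \<open>z\<close> with exponents below \<open>p ^ e\<close> are distinct and, by counting,
  exhaust the roots of unity of that exponent. Hence of two roots of unity of p-power order, the one
  of smaller order is a power of the other.\<close>

lemma root_of_unity_is_power:
  fixes z u :: complex
  assumes p: "Factorial_Ring.prime (p::nat)"
    and z: "z ^ (p ^ a) = 1"
    and u: "u ^ (p ^ (LEAST e. z ^ (p ^ e) = 1)) = 1"
  shows "\<exists>d::nat. u = z ^ d"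
proof -
  define e where "e = (LEAST e. z ^ (p ^ e) = 1)"
  have ze: "z ^ (p ^ e) = 1" unfolding e_def by (rule LeastI) (rule z)
  have pos: "0 < p ^ e" using p by (simp add: prime_gt_0_nat)
  have z0: "z \<noteq> 0" using ze pos by (auto simp: power_0_left)
  have neq: "z ^ i \<noteq> z ^ j" if "i < j" "j < p ^ e" for i j
  proof
    assume "z ^ i = z ^ j"
    then have "z ^ (j - i) = 1"
      using that z0 by (simp add: power_diff)
    then have g: "z ^ gcd (j - i) (p ^ e) = 1" using ze by (rule power_gcd_eq_one)
    obtain f where f: "gcd (j - i) (p ^ e) = p ^ f"
      using divides_primepow_nat[OF p] gcd_dvd2 by blast
    have "p ^ f \<le> j - i" using that f by (metis gcd_le1_nat zero_less_diff neq0_conv)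
    then have "p ^ f < p ^ e" using that by linarith
    then have "f < e" using p prime_gt_1_nat power_less_imp_less_exp by blast
    then show False using not_less_Least[of f "\<lambda>e. z ^ (p ^ e) = 1"] g f by (simp add: e_def)
  qed
  have inj: "inj_on (\<lambda>i. z ^ i) {..<p ^ e}"
  proof (rule inj_onI)
    fix i j assume "i \<in> {..<p ^ e}" "j \<in> {..<p ^ e}" "z ^ i = z ^ j"
    then show "i = j" using neq[of i j] neq[of j i] by (metis lessThan_iff linorder_neqE_nat)
  qed
  have "(\<lambda>i. z ^ i) ` {..<p ^ e} = {w. w ^ (p ^ e) = 1}"
  proof (rule card_subset_eq)
    show "finite {w::complex. w ^ (p ^ e) = 1}" using pos by (intro finite_roots_unity) linarith
    show "(\<lambda>i. z ^ i) ` {..<p ^ e} \<subseteq> {w. w ^ (p ^ e) = 1}"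
    proof clarify
      fix i
      have "(z ^ i) ^ (p ^ e) = (z ^ (p ^ e)) ^ i" by (metis mult.commute power_mult)
      then show "(z ^ i) ^ (p ^ e) = 1" using ze by simp
    qed
    show "card ((\<lambda>i. z ^ i) ` {..<p ^ e}) = card {w::complex. w ^ (p ^ e) = 1}"
      using inj pos by (simp add: card_image card_roots_unity_eq)
  qed
  then show ?thesis using u unfolding e_def[symmetric] by blast
qed

lemma prime_root_of_unity_is_power:
  fixes z u :: complex
  assumes p: "Factorial_Ring.prime (p::nat)" and z: "z ^ p = 1" "z \<noteq> 1" and u: "u ^ p = 1"
  shows "\<exists>d::nat. u = z ^ d"
proof (rule root_of_unity_is_power[OF p])
  show "z ^ (p ^ 1) = 1" using z by simp
  have "(LEAST e. z ^ (p ^ e) = 1) = 1"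
  proof (rule Least_equality)
    fix e assume "z ^ (p ^ e) = 1"
    then show "1 \<le> e" using z by (cases e) auto
  qed (use z in simp)
  then show "u ^ (p ^ (LEAST e. z ^ (p ^ e) = 1)) = 1" using u by simp
qed

lemma prime_root_power_eq_one_iff:
  fixes z :: complex
  assumes p: "Factorial_Ring.prime (p::nat)" and z: "z ^ p = 1" "z \<noteq> 1"
  shows "z ^ c = 1 \<longleftrightarrow> p dvd c"
proof
  assume c: "z ^ c = 1"
  show "p dvd c"
  proof (rule ccontr)
    assume "\<not> p dvd c"
    then have "gcd p c = 1" using p by (metis prime_imp_coprime coprime_iff_gcd_eq_1)
    then show False using power_gcd_eq_one[OF z(1) c] z by simp
  qed
qed (use z in \<open>auto simp: power_mult\<close>)

lemma exists_complex_nth_root: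
  assumes "n > 0" "c \<noteq> (0::complex)"
  shows "\<exists>z. z ^ n = c"
proof -
  have "{z. z ^ n = c} \<noteq> {}"
    using card_nth_roots[OF assms(2,1)] assms(1) by (metis card.empty less_irrefl)
  then show ?thesis by blast
qed

lemma exists_nontrivial_root_of_unity:
  assumes "n > 1"
  shows "\<exists>z::complex. z ^ n = 1 \<and> z \<noteq> 1"
proof (rule ccontr)
  assume "\<not> ?thesis"
  then have "{z::complex. z ^ n = 1} \<subseteq> {1}" by auto
  then have "card {z::complex. z ^ n = 1} \<le> card {1::complex}" by (intro card_mono) simp_all
  then show False using assms by (simp add: card_roots_unity_eq)
qed

section \<open>Characters\<close>

text \<open>Values off the carrier are arbitrary, so characters are compared through
  \<open>restrict\<close>. For \<open>n > 0\<close> such a character is trivial on all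
  \<open>n\<close>-th powers, which is how characters detect divisibility.\<close>

definition characters :: "('a, 'b) monoid_scheme \<Rightarrow> nat \<Rightarrow> ('a \<Rightarrow> complex) set" where
  "characters G n = {\<chi>. (\<forall>x\<in>carrier G. \<forall>y\<in>carrier G. \<chi> (x \<otimes>\<^bsub>G\<^esub> y) = \<chi> x * \<chi> y) \<and>
                        (\<forall>x\<in>carrier G. \<chi> x ^ n = 1)}"

context comm_group
begin

lemma character_mult:
  "\<chi> \<in> characters G n \<Longrightarrow> x \<in> carrier G \<Longrightarrow> y \<in> carrier G \<Longrightarrow> \<chi> (x \<otimes> y) = \<chi> x * \<chi> y"
  by (simp add: characters_def)

lemma character_power_eq_one: "\<chi> \<in> characters G n \<Longrightarrow> x \<in> carrier G \<Longrightarrow> \<chi> x ^ n = 1"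
  by (simp add: characters_def)

lemma character_nonzero:
  assumes "\<chi> \<in> characters G n" "n > 0" "x \<in> carrier G"
  shows "\<chi> x \<noteq> 0"
  using character_power_eq_one[OF assms(1,3)] assms(2) by (auto simp: power_0_left)

lemma character_one:
  assumes "\<chi> \<in> characters G n" "n > 0"
  shows "\<chi> \<one> = 1"
  using character_mult[OF assms(1), of \<one> \<one>] character_nonzero[OF assms, of \<one>] by simp

lemma character_nat_pow:
  assumes "\<chi> \<in> characters G n" "n > 0" "x \<in> carrier G"
  shows "\<chi> (x [^] (k::nat)) = \<chi> x ^ k"
  using assms by (induction k) (simp_all add: character_one character_mult)

lemma character_inv:
  assumes "\<chi> \<in> characters G n" "n > 0" "x \<in> carrier G"
  shows "\<chi> (inv x) = inverse (\<chi> x)"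
  using character_mult[OF assms(1), of x "inv x"] assms character_one[OF assms(1,2)]
    character_nonzero[OF assms] by (simp add: field_simps)

lemma characters_mono:
  assumes "m dvd n"
  shows "characters G m \<subseteq> characters G n"
  using assms by (auto simp: characters_def power_mult elim!: dvdE)

lemma characters_times_power:
  assumes "\<chi> \<in> characters G n" "\<psi> \<in> characters G n"
  shows "(\<lambda>x. \<chi> x * \<psi> x ^ d) \<in> characters G n"
proof -
  have "(\<psi> x ^ d) ^ n = 1" if "x \<in> carrier G" for x
    using character_power_eq_one[OF assms(2) that]
    by (metis mult.commute power_mult power_one)
  then show ?thesis
    using assms by (auto simp: characters_def power_mult_distrib)
qed

text \<open>The graph of a homomorphism from a subgroup into the nonzero complex numbers; the last
  clause is single-valuedness, tested over the identity. Extensions of such graphs are ordered by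
  inclusion, ready for Zorn's lemma.\<close>

definition partial_character :: "('a \<times> complex) set \<Rightarrow> bool" where
  "partial_character R \<longleftrightarrow> R \<subseteq> carrier G \<times> (- {0}) \<and> (\<one>, 1) \<in> R \<and>
     (\<forall>x a y b. (x, a) \<in> R \<longrightarrow> (y, b) \<in> R \<longrightarrow> (x \<otimes> y, a * b) \<in> R) \<and>
     (\<forall>x a. (x, a) \<in> R \<longrightarrow> (inv x, inverse a) \<in> R) \<and>
     (\<forall>a. (\<one>, a) \<in> R \<longrightarrow> a = 1)"

lemma partial_character_int_pow:
  assumes R: "partial_character R" and x: "(x, a) \<in> R"
  shows "(x [^] (i::int), a powi i) \<in> R"
proof -
  have nat: "(x [^] n, a ^ n) \<in> R" for n :: nat
  proof (induction n)
    case 0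
    then show ?case using R by (simp add: partial_character_def)
  next
    case (Suc n)
    then have "(x [^] n \<otimes> x, a ^ n * a) \<in> R" using R x by (auto simp: partial_character_def)
    then show ?case by (simp add: mult.commute)
  qed
  have x': "x \<in> carrier G" using R x by (auto simp: partial_character_def)
  show ?thesis
  proof (cases i rule: int_cases2)
    case (nonneg n)
    then show ?thesis using nat by (simp add: int_pow_int)
  next
    case (nonpos n)
    have "(inv (x [^] n), inverse (a ^ n)) \<in> R"
      using R nat[of n] by (auto simp: partial_character_def)
    then show ?thesis using nonpos x' by (simp add: int_pow_neg_int power_int_minus)
  qed
qed

text \<open>Modulo the domain of \<open>R\<close> the order of \<open>g\<close> is exactly
  \<open>p\<close>, so any \<open>p\<close>-th root of the value already fixed at
  \<open>g [^] p\<close> is a consistent value at \<open>g\<close>.\<close>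

lemma partial_character_extend:
  assumes R: "partial_character R" and p: "Factorial_Ring.prime (p::nat)"
    and g: "g \<in> carrier G" "g \<notin> fst ` R" and gp: "(g [^] p, \<zeta> ^ p) \<in> R"
  shows "\<exists>R'. partial_character R' \<and> R \<subseteq> R' \<and> (g, \<zeta>) \<in> R'"
proof -
  define R' where "R' = {(x \<otimes> g [^] j, a * \<zeta> powi j) | x a (j::int). (x, a) \<in> R}"
  have car: "x \<in> carrier G" "a \<noteq> 0" if "(x, a) \<in> R" for x a
    using R that by (auto simp: partial_character_def)
  have \<zeta>0: "\<zeta> \<noteq> 0" using car(2)[OF gp] p by (auto simp: power_0_left prime_gt_0_nat)
  have one: "(\<one>, 1) \<in> R" using R by (simp add: partial_character_def)
  have mult: "(x \<otimes> y, a * b) \<in> R" if "(x, a) \<in> R" "(y, b) \<in> R" for x a y b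
    using R that by (simp add: partial_character_def)
  have invR: "(inv x, inverse a) \<in> R" if "(x, a) \<in> R" for x a
    using R that by (simp add: partial_character_def)
  have fun_R: "a = 1" if "(\<one>, a) \<in> R" for a
    using R that by (simp add: partial_character_def)
  have gpi: "(g [^] (int p * i), \<zeta> powi (int p * i)) \<in> R" for i
  proof -
    have "((g [^] p) [^] i, (\<zeta> ^ p) powi i) \<in> R" using R gp by (rule partial_character_int_pow)
    moreover have "(g [^] p) [^] i = g [^] (int p * i)"
      using int_pow_pow[OF g(1), of "int p" i] by (simp add: int_pow_int)
    ultimately show ?thesis by (simp add: power_int_mult)
  qed
  \<comment> \<open>Otherwise Bezout writes \<open>g\<close> as a product of powers of
    \<open>g [^] p\<close> and \<open>g [^] j\<close>, placing it in the domain. This is what makes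
    \<open>R'\<close> single-valued.\<close>
  have pdvd: "int p dvd j" if gj: "g [^] j \<in> fst ` R" for j :: int
  proof (rule ccontr)
    assume "\<not> int p dvd j"
    then have "coprime (int p) j"
      using p by (simp add: prime_imp_coprime)
    then obtain u v where uv: "u * int p + v * j = 1"
      by (metis bezout_int coprime_iff_gcd_eq_1)
    obtain b where b: "(g [^] j, b) \<in> R" using gj by fastforce
    have "((g [^] j) [^] v, b powi v) \<in> R" using R b by (rule partial_character_int_pow)
    then have "(g [^] (int p * u) \<otimes> (g [^] j) [^] v, \<zeta> powi (int p * u) * b powi v) \<in> R"
      using mult gpi by blast
    moreover have "g [^] (int p * u) \<otimes> (g [^] j) [^] v = g"
      using g uv by (simp add: int_pow_pow int_pow_mult[symmetric] mult.commute)
    ultimately show False using g by force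
  qed
  have "partial_character R'"
    unfolding partial_character_def
  proof (intro conjI allI impI)
    show "R' \<subseteq> carrier G \<times> - {0}"
      using car g \<zeta>0 by (auto simp: R'_def)
    have "(\<one> \<otimes> g [^] (0::int), 1 * \<zeta> powi 0) \<in> R'" unfolding R'_def using one by blast
    then show "(\<one>, 1) \<in> R'" by simp
  next
    fix x a y b assume "(x, a) \<in> R'" "(y, b) \<in> R'"
    then obtain x' a' i y' b' j where *: "(x', a') \<in> R" "(y', b') \<in> R"
      and eq: "x = x' \<otimes> g [^] (i::int)" "a = a' * \<zeta> powi i" "y = y' \<otimes> g [^] (j::int)" "b = b' * \<zeta> powi j"
      unfolding R'_def by blast
    have "x \<otimes> y = (x' \<otimes> y') \<otimes> g [^] (i + j)"
      using car(1)[OF *(1)] car(1)[OF *(2)] g unfolding eq by (simp add: int_pow_mult m_ac)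
    moreover have "a * b = (a' * b') * \<zeta> powi (i + j)"
      unfolding eq using \<zeta>0 by (simp add: power_int_add)
    ultimately show "(x \<otimes> y, a * b) \<in> R'" unfolding R'_def using mult[OF *] by blast
  next
    fix x a assume "(x, a) \<in> R'"
    then obtain x' a' i where *: "(x', a') \<in> R"
      and eq: "x = x' \<otimes> g [^] (i::int)" "a = a' * \<zeta> powi i" unfolding R'_def by blast
    have "inv x = inv x' \<otimes> g [^] (- i)"
      using car(1)[OF *(1)] g unfolding eq by (simp add: inv_mult int_pow_neg)
    moreover have "inverse a = inverse a' * \<zeta> powi (- i)"
      unfolding eq by (simp add: power_int_minus)
    ultimately show "(inv x, inverse a) \<in> R'" unfolding R'_def using invR[OF *] by blast
  next
    fix c assume "(\<one>, c) \<in> R'"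
    then obtain x a j where *: "(x, a) \<in> R"
      and eq: "\<one> = x \<otimes> g [^] (j::int)" "c = a * \<zeta> powi j" unfolding R'_def by blast
    have "g [^] j = inv x"
      using eq(1) car(1)[OF *] g by (metis int_pow_closed inv_equality inv_inv inv_closed)
    then have "g [^] j \<in> fst ` R" using invR[OF *] by force
    then obtain i where i: "j = int p * i" using pdvd by blast
    have "(x \<otimes> g [^] j, a * \<zeta> powi j) \<in> R" using mult[OF * gpi[of i]] i by simp
    then show "c = 1" using eq fun_R by simp
  qed
  moreover have "R \<subseteq> R'"
  proof
    fix r assume r: "r \<in> R"
    obtain x a where xa: "r = (x, a)" by force
    have "(x \<otimes> g [^] (0::int), a * \<zeta> powi 0) \<in> R'" unfolding R'_def using r xa by blast
    then show "r \<in> R'" using r xa car by simp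
  qed
  moreover have "(\<one> \<otimes> g [^] (1::int), 1 * \<zeta> powi 1) \<in> R'" unfolding R'_def using one by blast
  then have "(g, \<zeta>) \<in> R'" using g by (simp add: int_pow_1)
  ultimately show ?thesis by blast
qed

lemma partial_character_Union_chain:
  assumes ne: "C \<noteq> {}" and ch: "\<And>R S. R \<in> C \<Longrightarrow> S \<in> C \<Longrightarrow> R \<subseteq> S \<or> S \<subseteq> R"
    and pc: "\<And>R. R \<in> C \<Longrightarrow> partial_character R"
  shows "partial_character (\<Union>C)"
  unfolding partial_character_def
proof (intro conjI allI impI)
  show "\<Union>C \<subseteq> carrier G \<times> - {0}" using pc unfolding partial_character_def by blast
  show "(\<one>, 1) \<in> \<Union>C" using ne pc unfolding partial_character_def by blast
next
  fix x a y b assume "(x, a) \<in> \<Union>C" "(y, b) \<in> \<Union>C"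
  then obtain R S where RS: "R \<in> C" "S \<in> C" "(x, a) \<in> R" "(y, b) \<in> S" by blast
  define Z where "Z = R \<union> S"
  have Z: "Z \<in> C" using ch[OF RS(1,2)] RS(1,2) unfolding Z_def by (metis sup.absorb2 sup.absorb1)
  then have "(x \<otimes> y, a * b) \<in> Z"
    using pc[OF Z] RS unfolding partial_character_def Z_def by blast
  then show "(x \<otimes> y, a * b) \<in> \<Union>C" using Z by blast
next
  fix x a assume "(x, a) \<in> \<Union>C"
  then show "(inv x, inverse a) \<in> \<Union>C" using pc unfolding partial_character_def by blast
next
  fix a assume "(\<one>, a) \<in> \<Union>C"
  then show "a = 1" using pc unfolding partial_character_def by blast
qed

text \<open>On the subgroup of \<open>p ^ k\<close>-th powers take the trivial character. As
  \<open>s\<close> lies outside but \<open>s [^] p\<close> is trivial, a nontrivial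
  \<open>p\<close>-th root of unity may be prescribed at \<open>s\<close>. A maximal extension is
  total, and its triviality on \<open>p ^ k\<close>-th powers forces values of exponent
  \<open>p ^ k\<close>.\<close>

lemma exists_separating_character:
  assumes p: "Factorial_Ring.prime (p::nat)"
    and s: "s \<in> carrier G" "s [^] p = \<one>" and ht: "\<And>y. y \<in> carrier G \<Longrightarrow> s \<noteq> y [^] (p ^ k)"
  shows "\<exists>\<chi> \<in> characters G (p ^ k). \<chi> s \<noteq> 1"
proof -
  define R0 where "R0 = (\<lambda>y. (y [^] (p ^ k), 1::complex)) ` carrier G"
  have R0: "partial_character R0"
    unfolding partial_character_def
  proof (intro conjI allI impI)
    show "R0 \<subseteq> carrier G \<times> - {0}" by (auto simp: R0_def)
    have "(\<one> [^] (p ^ k), 1::complex) \<in> R0" unfolding R0_def by blast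
    then show "(\<one>, 1) \<in> R0" by simp
  next
    fix x a y b assume "(x, a) \<in> R0" "(y, b) \<in> R0"
    then obtain x' y' where *: "x' \<in> carrier G" "y' \<in> carrier G" "x = x' [^] (p ^ k)" "y = y' [^] (p ^ k)" "a = 1" "b = 1"
      unfolding R0_def by blast
    then have "x \<otimes> y = (x' \<otimes> y') [^] (p ^ k)" by (simp add: nat_pow_distrib)
    then show "(x \<otimes> y, a * b) \<in> R0" unfolding R0_def using * by auto
  next
    fix x a assume "(x, a) \<in> R0"
    then obtain x' where *: "x' \<in> carrier G" "x = x' [^] (p ^ k)" "a = 1"
      unfolding R0_def by blast
    then have "inv x = (inv x') [^] (p ^ k)" by (simp add: nat_pow_inv)
    then show "(inv x, inverse a) \<in> R0" unfolding R0_def using * by auto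
  qed (auto simp: R0_def)
  obtain \<zeta> :: complex where \<zeta>: "\<zeta> ^ p = 1" "\<zeta> \<noteq> 1"
    using exists_nontrivial_root_of_unity p prime_gt_1_nat by blast
  have "s \<notin> fst ` R0" using ht by (force simp: R0_def)
  moreover have "(s [^] p, \<zeta> ^ p) \<in> R0" using R0 s \<zeta> by (simp add: partial_character_def)
  ultimately obtain R1 where R1: "partial_character R1" "R0 \<subseteq> R1" "(s, \<zeta>) \<in> R1"
    using partial_character_extend[OF R0 p s(1)] by blast
  define P where "P = {R. partial_character R \<and> R1 \<subseteq> R}"
  have "\<exists>M\<in>P. \<forall>N\<in>P. M \<subseteq> N \<longrightarrow> N = M"
  proof (rule subset_Zorn_nonempty)
    show "P \<noteq> {}" using R1 by (auto simp: P_def)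
    fix C assume C: "C \<noteq> {}" "subset.chain P C"
    have "partial_character (\<Union>C)"
    proof (rule partial_character_Union_chain[OF C(1)])
      show "R \<subseteq> S \<or> S \<subseteq> R" if "R \<in> C" "S \<in> C" for R S
        using C(2) that unfolding subset.chain_def by blast
      show "partial_character R" if "R \<in> C" for R
        using C(2) that unfolding subset.chain_def P_def by blast
    qed
    moreover have "R1 \<subseteq> \<Union>C"
      using C unfolding subset.chain_def P_def by blast
    ultimately show "\<Union>C \<in> P" by (simp add: P_def)
  qed
  then obtain M where MP: "M \<in> P" and maxP: "\<forall>N\<in>P. M \<subseteq> N \<longrightarrow> N = M" ..
  have M: "partial_character M" "R1 \<subseteq> M" using MP by (simp_all add: P_def)
  have max: "N = M" if "partial_character N" "M \<subseteq> N" for N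
    using that M(2) maxP by (simp add: P_def)
  have pk: "(y [^] (p ^ k), 1) \<in> M" if "y \<in> carrier G" for y
    using that M R1 unfolding R0_def by blast
  have dom: "g \<in> fst ` M" if g: "g \<in> carrier G" for g
  proof (rule ccontr)
    assume ng: "g \<notin> fst ` M"
    have ex: "\<exists>i. g [^] (p ^ i) \<in> fst ` M" using pk[OF g] by force
    \<comment> \<open>The domain contains all \<open>p ^ k\<close>-th powers, so such an exponent
      exists. The element \<open>h\<close> one exponent earlier is outside the domain while its
      \<open>p\<close>-th power is inside, which is the situation of the one-step extension.\<close>
    define i where "i = (LEAST i. g [^] (p ^ i) \<in> fst ` M)"
    have i: "g [^] (p ^ i) \<in> fst ` M" unfolding i_def using ex by (rule LeastI_ex)
    have "i \<noteq> 0"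
    proof
      assume "i = 0"
      then show False using ng i g by (simp add: nat_pow_eone)
    qed
    then obtain j where j: "i = Suc j" by (cases i) auto
    define h where "h = g [^] (p ^ j)"
    have h: "h \<in> carrier G" "h \<notin> fst ` M"
      using g not_less_Least[of j "\<lambda>i. g [^] (p ^ i) \<in> fst ` M"] j by (auto simp: h_def i_def)
    have "h [^] p = g [^] (p ^ i)" using g by (simp add: h_def j nat_pow_pow mult.commute)
    then obtain c where c: "(h [^] p, c) \<in> M" using i by auto
    then have "c \<noteq> 0" using M by (auto simp: partial_character_def)
    then obtain \<xi> where "\<xi> ^ p = c" using exists_complex_nth_root p prime_gt_0_nat by blast
    then obtain N where "partial_character N" "M \<subseteq> N" "(h, \<xi>) \<in> N"
      using partial_character_extend[OF M(1) p h] c by blast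
    then show False using max[of N] h by force
  qed
  define \<chi> where "\<chi> x = (THE a. (x, a) \<in> M)" for x
  have uniq: "a = b" if "(x, a) \<in> M" "(x, b) \<in> M" for x a b
  proof -
    have "(x \<otimes> inv x, a * inverse b) \<in> M" "x \<in> carrier G" "b \<noteq> 0"
      using M that unfolding partial_character_def by blast+
    then have "a * inverse b = 1" using M unfolding partial_character_def by simp
    then show ?thesis using \<open>b \<noteq> 0\<close> by (simp add: field_simps)
  qed
  have \<chi>I: "\<chi> x = a" if "(x, a) \<in> M" for x a
    unfolding \<chi>_def using that uniq by blast
  have \<chi>: "(x, \<chi> x) \<in> M" if "x \<in> carrier G" for x
    using dom[OF that] \<chi>I by force
  have "\<chi> \<in> characters G (p ^ k)"
    unfolding characters_def
  proof (intro CollectI conjI ballI)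
    fix x y assume "x \<in> carrier G" "y \<in> carrier G"
    then show "\<chi> (x \<otimes> y) = \<chi> x * \<chi> y"
      using \<chi>I \<chi> M(1) by (simp add: partial_character_def)
  next
    fix x assume x: "x \<in> carrier G"
    have "(x [^] int (p ^ k), \<chi> x powi int (p ^ k)) \<in> M"
      using M(1) \<chi>[OF x] by (rule partial_character_int_pow)
    then show "\<chi> x ^ (p ^ k) = 1" using uniq[OF _ pk[OF x]] by (simp only: int_pow_int power_int_of_nat)
  qed
  moreover have "\<chi> s = \<zeta>" using \<chi>I R1(3) M(2) by blast
  ultimately show ?thesis using \<zeta> by blast
qed

end

section \<open>Infinite families of restrictions\<close>

abbreviation restrictions :: "('a \<Rightarrow> complex) set \<Rightarrow> 'a set \<Rightarrow> ('a \<Rightarrow> complex) set" where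
  "restrictions H W \<equiv> (\<lambda>\<chi>. restrict \<chi> W) ` H"

text \<open>The values at \<open>g\<close> of finitely many members of \<open>H\<close> are powers of the one of
  largest order, so dividing by powers of a single \<open>\<xi>\<^sub>0\<close> makes them all trivial at \<open>g\<close>.\<close>

lemma infinite_restrictions_trivial_at:
  fixes H :: "('a \<Rightarrow> complex) set"
  assumes p: "Factorial_Ring.prime (p::nat)"
    and closed: "\<And>\<chi> \<psi> d. \<chi> \<in> H \<Longrightarrow> \<psi> \<in> H \<Longrightarrow> (\<lambda>x. \<chi> x * \<psi> x ^ (d::nat)) \<in> H"
    and root: "\<And>\<chi>. \<chi> \<in> H \<Longrightarrow> \<exists>a. \<chi> g ^ (p ^ a) = 1"
    and W: "\<And>\<chi> w. \<chi> \<in> H \<Longrightarrow> w \<in> W \<Longrightarrow> \<chi> w ^ p = 1"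
    and inf: "infinite (restrictions H W)"
  shows "infinite (restrictions {\<chi> \<in> H. \<chi> g = 1} W)"
proof
  assume fin: "finite (restrictions {\<chi> \<in> H. \<chi> g = 1} W)"
  define C where "C = restrictions {\<chi> \<in> H. \<chi> g = 1} W"
  have p0: "p > 0" using p by (rule prime_gt_0_nat)
  \<comment> \<open>One more than the number of pairs of a restriction in \<open>C\<close> and an
    exponent below \<open>p\<close>; every member of \<open>Q\<close> will be recovered from such a
    pair.\<close>
  obtain Q where Q: "finite Q" "card Q = Suc (card C * p)" "Q \<subseteq> restrictions H W"
    using infinite_arbitrarily_large[OF inf] by blast
  obtain H0 where H0: "H0 \<subseteq> H" "finite H0" "Q = restrictions H0 W"
    using finite_subset_image[OF Q(1,3)] by blast
  define e where "e \<xi> = (LEAST e. (\<xi> g :: complex) ^ (p ^ e) = 1)" for \<xi> :: "'a \<Rightarrow> complex"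
  have ne: "H0 \<noteq> {}" using Q H0 by auto
  then have "Max (e ` H0) \<in> e ` H0" using H0 by (intro Max_in) auto
  then obtain \<xi>0 where \<xi>0: "\<xi>0 \<in> H0" "e \<xi>0 = Max (e ` H0)" by auto
  have le: "e \<xi> \<le> e \<xi>0" if "\<xi> \<in> H0" for \<xi>
    using that H0 \<xi>0 by simp
  have eroot: "\<xi> g ^ (p ^ e \<xi>) = 1" if "\<xi> \<in> H" for \<xi>
    unfolding e_def using root[OF that] by (rule LeastI_ex)
  have "Q \<subseteq> (\<lambda>(\<rho>, j). restrict (\<lambda>w. \<rho> w * inverse (\<xi>0 w) ^ j) W) ` (C \<times> {..<p})"
  proof
    fix \<rho> assume "\<rho> \<in> Q"
    then obtain \<xi> where \<xi>: "\<xi> \<in> H0" "\<rho> = restrict \<xi> W" using H0 by auto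
    obtain b where b: "e \<xi>0 = e \<xi> + b" using le[OF \<xi>(1)] le_Suc_ex by blast
    have "\<xi> g ^ (p ^ e \<xi>0) = 1"
      using eroot[of \<xi>] \<xi> H0 by (auto simp: b power_add power_mult)
    then have "inverse (\<xi> g) ^ (p ^ e \<xi>0) = 1" by (simp add: power_inverse)
    then obtain d where d: "inverse (\<xi> g) = \<xi>0 g ^ d"
      using root_of_unity_is_power[OF p, of "\<xi>0 g"] eroot[of \<xi>0] \<xi>0 H0 unfolding e_def by blast
    have nz: "\<xi> g \<noteq> 0" using eroot[of \<xi>] \<xi> H0 p0 by (auto simp: power_0_left)
    define \<psi> where "\<psi> = (\<lambda>x. \<xi> x * \<xi>0 x ^ d)"
    have "\<psi> \<in> H" unfolding \<psi>_def using \<xi> \<xi>0 H0 by (blast intro: closed)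
    moreover have "\<psi> g = 1" unfolding \<psi>_def using nz d[symmetric] by simp
    ultimately have "restrict \<psi> W \<in> C" by (auto simp: C_def)
    \<comment> \<open>Dividing \<open>\<psi>\<close> by the \<open>d\<close>-th power of
      \<open>\<xi>0\<close> returns \<open>\<xi>\<close>, and on \<open>W\<close> only the residue
      of \<open>d\<close> modulo \<open>p\<close> counts.\<close>
    moreover have "\<rho> = restrict (\<lambda>w. restrict \<psi> W w * inverse (\<xi>0 w) ^ (d mod p)) W"
    proof
      fix w
      show "\<rho> w = restrict (\<lambda>w. restrict \<psi> W w * inverse (\<xi>0 w) ^ (d mod p)) W w"
      proof (cases "w \<in> W")
        case True
        then have w: "\<xi>0 w ^ p = 1" using W \<xi>0 H0 by blast
        then have "\<xi>0 w \<noteq> 0" using p0 by (auto simp: power_0_left)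
        moreover have "\<xi>0 w ^ (d mod p) = \<xi>0 w ^ d"
        proof -
          have "\<xi>0 w ^ d = \<xi>0 w ^ (p * (d div p) + d mod p)" by simp
          also have "\<dots> = \<xi>0 w ^ (d mod p)" using w by (simp only: power_add power_mult) simp
          finally show ?thesis by simp
        qed
        ultimately show ?thesis using True \<xi> by (simp add: \<psi>_def power_inverse)
      qed (use \<xi> in simp)
    qed
    moreover have "d mod p < p" using p0 by simp
    ultimately show "\<rho> \<in> (\<lambda>(\<rho>, j). restrict (\<lambda>w. \<rho> w * inverse (\<xi>0 w) ^ j) W) ` (C \<times> {..<p})"
      by (intro image_eqI[of _ _ "(restrict \<psi> W, d mod p)"]) auto
  qed
  moreover have "finite (C \<times> {..<p})" using fin by (simp add: C_def)
  ultimately have "card Q \<le> card (C \<times> {..<p})" by (meson surj_card_le)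
  then show False using Q by (simp add: card_cartesian_product)
qed

text \<open>One element of \<open>F\<close> at a time: the characters trivial on the part already
  treated are closed under the same operation, so the one-element case applies to them.\<close>

lemma infinite_restrictions_trivial_on:
  fixes H :: "('a \<Rightarrow> complex) set"
  assumes p: "Factorial_Ring.prime (p::nat)"
    and F: "finite F"
    and closed: "\<And>\<chi> \<psi> d. \<chi> \<in> H \<Longrightarrow> \<psi> \<in> H \<Longrightarrow> (\<lambda>x. \<chi> x * \<psi> x ^ (d::nat)) \<in> H"
    and root: "\<And>\<chi> g. \<chi> \<in> H \<Longrightarrow> g \<in> F \<Longrightarrow> \<exists>a. \<chi> g ^ (p ^ a) = 1"
    and W: "\<And>\<chi> w. \<chi> \<in> H \<Longrightarrow> w \<in> W \<Longrightarrow> \<chi> w ^ p = 1"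
    and inf: "infinite (restrictions H W)"
  shows "infinite (restrictions {\<chi> \<in> H. \<forall>g\<in>F. \<chi> g = 1} W)"
  using F root
proof (induction F rule: finite_induct)
  case empty
  have eq: "{\<chi> \<in> H. \<forall>g\<in>{}. \<chi> g = 1} = H" by simp
  show ?case unfolding eq by (rule inf)
next
  case (insert g F)
  define H' where "H' = {\<chi> \<in> H. \<forall>g\<in>F. \<chi> g = 1}"
  have "infinite (restrictions {\<chi> \<in> H'. \<chi> g = 1} W)"
  proof (rule infinite_restrictions_trivial_at[OF p])
    show "infinite (restrictions H' W)" unfolding H'_def using insert by blast
  qed (use closed insert.prems W in \<open>auto simp: H'_def\<close>)
  moreover have "{\<chi> \<in> H'. \<chi> g = 1} = {\<chi> \<in> H. \<forall>g\<in>insert g F. \<chi> g = 1}"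
    by (auto simp: H'_def)
  ultimately show ?case by (simp only: not_False_eq_True)
qed

lemma infinite_nontrivial_if_infinite_restrictions:
  assumes "infinite (restrictions H W)"
  shows "infinite {\<chi> \<in> H. \<exists>w\<in>W. \<chi> w \<noteq> 1}"
proof
  assume "finite {\<chi> \<in> H. \<exists>w\<in>W. \<chi> w \<noteq> 1}"
  moreover have "restrictions H W \<subseteq> insert (restrict (\<lambda>_. 1) W) (restrictions {\<chi> \<in> H. \<exists>w\<in>W. \<chi> w \<noteq> 1} W)"
  proof clarify
    fix \<chi> assume \<chi>: "\<chi> \<in> H" "restrict \<chi> W \<notin> restrictions {\<chi> \<in> H. \<exists>w\<in>W. \<chi> w \<noteq> 1} W"
    then have "\<forall>w\<in>W. \<chi> w = 1" by blast
    then show "restrict \<chi> W = restrict (\<lambda>_. 1) W" by (intro restrict_ext) simp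
  qed
  ultimately show False using assms by (meson finite.insertI finite_imageI finite_subset)
qed

section \<open>Characters on the elements of order p of given height\<close>

context comm_group
begin

text \<open>In additive notation this is \<open>G[p] \<inter> p^k G\<close>, the part of the
  \<open>p\<close>-socle of \<open>p\<close>-height at least \<open>k\<close>.\<close>

definition socle :: "nat \<Rightarrow> nat \<Rightarrow> 'a set" where
  "socle p k = {x \<in> carrier G. x [^] p = \<one> \<and> (\<exists>y\<in>carrier G. x = y [^] (p ^ k))}"

lemma subgroup_socle: "subgroup (socle p k) G"
proof (rule subgroupI)
  have "\<one> = \<one> [^] (p ^ k)" by simp
  then have "\<one> \<in> socle p k" unfolding socle_def using one_closed nat_pow_one by blast
  then show "socle p k \<noteq> {}" by blast
next
  fix x assume "x \<in> socle p k"
  then obtain y where "x \<in> carrier G" "x [^] p = \<one>" "y \<in> carrier G" "x = y [^] (p ^ k)"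
    by (auto simp: socle_def)
  moreover from this have "inv x = inv y [^] (p ^ k)" by (simp add: nat_pow_inv)
  ultimately show "inv x \<in> socle p k"
    unfolding socle_def using nat_pow_inv[of x p] by (simp, metis inv_closed)
next
  fix x x' assume "x \<in> socle p k" "x' \<in> socle p k"
  then obtain y y' where "x \<in> carrier G" "x [^] p = \<one>" "y \<in> carrier G" "x = y [^] (p ^ k)"
    "x' \<in> carrier G" "x' [^] p = \<one>" "y' \<in> carrier G" "x' = y' [^] (p ^ k)"
    by (auto simp: socle_def)
  moreover from this have "x \<otimes> x' = (y \<otimes> y') [^] (p ^ k)" by (simp add: nat_pow_distrib)
  ultimately show "x \<otimes> x' \<in> socle p k"
    unfolding socle_def using nat_pow_distrib[of x x' p] by (simp, metis m_closed)
qed (auto simp: socle_def)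

lemma socle_antimono:
  assumes "k \<le> l"
  shows "socle p l \<subseteq> socle p k"
proof
  fix x assume "x \<in> socle p l"
  then obtain y where y: "x \<in> carrier G" "x [^] p = \<one>" "y \<in> carrier G" "x = y [^] (p ^ l)"
    by (auto simp: socle_def)
  obtain j where "l = j + k" using assms by (metis le_Suc_ex add.commute)
  then have "x = (y [^] (p ^ j)) [^] (p ^ k)" using y by (simp add: nat_pow_pow power_add)
  then show "x \<in> socle p k" using y by (auto simp: socle_def)
qed

lemma character_power_prime_eq_one:
  assumes "\<chi> \<in> characters G n" "n > 0" "x \<in> carrier G" "x [^] (p::nat) = \<one>"
  shows "\<chi> x ^ p = 1"
  using character_nat_pow[OF assms(1-3), of p] assms by (simp add: character_one)

text \<open>The kernel of \<open>\<xi>\<close> in \<open>W\<close> has index 1 or \<open>p\<close>.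
  A member of \<open>H\<close> is determined on \<open>W\<close> by its restriction to the kernel
  and its value at one \<open>v\<close> outside; that value is a \<open>p\<close>-th root of unity,
  so only finitely many restrictions to \<open>W\<close> agree on the kernel.\<close>

lemma infinite_restrictions_kernel:
  assumes p: "Factorial_Ring.prime (p::nat)"
    and sub: "subgroup W G" and W: "\<And>w. w \<in> W \<Longrightarrow> w [^] p = \<one>"
    and chars: "\<And>\<chi>. \<chi> \<in> insert \<xi> H \<Longrightarrow> \<exists>k. \<chi> \<in> characters G (p ^ k)"
    and inf: "infinite (restrictions H W)"
  shows "infinite (restrictions H {w \<in> W. \<xi> w = 1})"
proof (cases "\<forall>w\<in>W. \<xi> w = 1")
  case True
  then have "{w \<in> W. \<xi> w = 1} = W" by auto
  then show ?thesis using inf by simp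
next
  case False
  then obtain v where v: "v \<in> W" "\<xi> v \<noteq> 1" by blast
  have pk: "p ^ k > 0" for k using p by (simp add: prime_gt_0_nat)
  have car: "w \<in> carrier G" if "w \<in> W" for w by (rule subgroup.mem_carrier[OF sub that])
  have root: "\<chi> w ^ p = 1" if \<chi>: "\<chi> \<in> insert \<xi> H" and w: "w \<in> W" for \<chi> w
  proof -
    obtain k where "\<chi> \<in> characters G (p ^ k)" using chars[OF \<chi>] by blast
    then show ?thesis using pk car[OF w] W[OF w] by (rule character_power_prime_eq_one)
  qed
  define U where "U = {w \<in> W. \<xi> w = 1}"
  define \<Phi> where "\<Phi> \<rho> = (restrict \<rho> U, \<rho> v)" for \<rho> :: "'a \<Rightarrow> complex"
  have agree: "\<chi> w = \<psi> w"
    if \<chi>: "\<chi> \<in> H" "\<psi> \<in> H" and eq: "\<And>u. u \<in> U \<Longrightarrow> \<chi> u = \<psi> u" "\<chi> v = \<psi> v" and w: "w \<in> W" for \<chi> \<psi> w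
  proof -
    obtain d :: nat where d: "\<xi> w = \<xi> v ^ d"
      using prime_root_of_unity_is_power[OF p] root v w by blast
    obtain k where k: "\<xi> \<in> characters G (p ^ k)" using chars by blast
    \<comment> \<open>Since \<open>\<xi> w\<close> is the \<open>d\<close>-th power of
      \<open>\<xi> v\<close>, removing \<open>v [^] d\<close> from \<open>w\<close> lands in the
      kernel.\<close>
    define u where "u = w \<otimes> inv (v [^] d)"
    have vd: "v [^] d \<in> W"
      using sub v(1) by (induction d) (auto simp: subgroup.one_closed subgroup.m_closed)
    have uW: "u \<in> W"
      unfolding u_def using sub w vd by (simp add: subgroup.m_closed subgroup.m_inv_closed)
    have cl: "v \<in> carrier G" "w \<in> carrier G" "u \<in> carrier G" using car v w uW by auto
    have "\<xi> u = \<xi> w * inverse (\<xi> v ^ d)"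
      unfolding u_def using cl k pk by (simp add: character_mult character_inv character_nat_pow)
    moreover have "\<xi> v \<noteq> 0" using character_nonzero k pk cl by blast
    ultimately have "\<xi> u = 1" by (simp add: d)
    then have uU: "u \<in> U" using uW by (simp add: U_def)
    have wu: "w = u \<otimes> v [^] d" unfolding u_def using cl by (simp add: m_assoc)
    have val: "\<theta> w = \<theta> u * \<theta> v ^ d" if \<theta>: "\<theta> \<in> H" for \<theta>
    proof -
      obtain j where "\<theta> \<in> characters G (p ^ j)" using chars \<theta> by blast
      then show ?thesis using cl pk
        by (subst wu) (simp add: character_mult character_nat_pow)
    qed
    show ?thesis unfolding val[OF \<chi>(1)] val[OF \<chi>(2)] eq(2) eq(1)[OF uU] ..
  qed
  have "inj_on \<Phi> (restrictions H W)"
  proof (rule inj_onI)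
    fix \<rho> \<sigma> assume "\<rho> \<in> restrictions H W" "\<sigma> \<in> restrictions H W" and eq: "\<Phi> \<rho> = \<Phi> \<sigma>"
    then obtain \<chi> \<psi> where *: "\<chi> \<in> H" "\<psi> \<in> H" "\<rho> = restrict \<chi> W" "\<sigma> = restrict \<psi> W" by blast
    have "\<chi> u = \<psi> u" if "u \<in> U" for u
    proof -
      have "restrict \<rho> U u = restrict \<sigma> U u" using eq by (simp add: \<Phi>_def)
      then show ?thesis using that * by (simp add: U_def)
    qed
    moreover have "\<chi> v = \<psi> v" using eq * v by (simp add: \<Phi>_def)
    ultimately show "\<rho> = \<sigma>" using agree *(1,2) unfolding *(3,4) by (intro restrict_ext) blast
  qed
  then have "infinite (\<Phi> ` restrictions H W)" using inf finite_imageD by blast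
  moreover have "\<Phi> ` restrictions H W \<subseteq> restrictions H U \<times> {z. z ^ p = 1}"
  proof
    fix y assume "y \<in> \<Phi> ` restrictions H W"
    then obtain \<chi> where *: "\<chi> \<in> H" "y = \<Phi> (restrict \<chi> W)" by blast
    have "restrict (restrict \<chi> W) U = restrict \<chi> U" by (auto simp: U_def restrict_def)
    then show "y \<in> restrictions H U \<times> {z. z ^ p = 1}"
      using * root v by (auto simp: \<Phi>_def)
  qed
  moreover have "finite {z::complex. z ^ p = 1}"
    using p prime_gt_0_nat by (intro finite_roots_unity) (simp add: Suc_leI)
  ultimately show ?thesis unfolding U_def[symmetric] by (meson finite_SigmaI finite_subset)
qed

text \<open>This supplies the infinite finite intersections of the later filter base. Demanding
  triviality on \<open>F\<close> leaves infinitely many restrictions to the socle, and so does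
  cutting the socle down by the kernels of the first \<open>k\<close> characters, one kernel at a
  time. At most one restriction to what remains is trivial.\<close>

lemma infinite_index_set:
  fixes \<chi> :: "nat \<Rightarrow> 'a \<Rightarrow> complex"
  assumes p: "Factorial_Ring.prime (p::nat)"
    and chars: "\<And>n. \<exists>k. \<chi> n \<in> characters G (p ^ k)"
    and closed: "\<And>m n d. (\<lambda>x. \<chi> m x * \<chi> n x ^ (d::nat)) \<in> range \<chi>"
    and inf: "infinite (restrictions (range \<chi>) (socle p l))"
    and F: "finite F" "F \<subseteq> carrier G"
  shows "infinite {n. (\<forall>g\<in>F. \<chi> n g = 1) \<and> (\<exists>w\<in>socle p l. (\<forall>i<k. \<chi> i w = 1) \<and> \<chi> n w \<noteq> 1)}"
proof -
  have p0: "p ^ k > 0" for k using p by (simp add: prime_gt_0_nat)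
  define H where "H = {\<psi> \<in> range \<chi>. \<forall>g\<in>F. \<psi> g = 1}"
  have root: "\<exists>a. \<psi> g ^ (p ^ a) = 1" if "\<psi> \<in> range \<chi>" "g \<in> carrier G" for \<psi> g
    using that chars character_power_eq_one by blast
  have W: "\<psi> w ^ p = 1" if \<psi>: "\<psi> \<in> range \<chi>" and w: "w \<in> socle p l" for \<psi> w
  proof -
    obtain n k where k: "\<psi> = \<chi> n" "\<chi> n \<in> characters G (p ^ k)" using \<psi> chars by blast
    show ?thesis using character_power_prime_eq_one[OF k(2) p0] w k(1) by (simp add: socle_def)
  qed
  have H: "infinite (restrictions H (socle p l))"
    unfolding H_def
    by (rule infinite_restrictions_trivial_on[OF p F(1) _ _ _ inf])
      (use closed root W F in blast)+
  define V where "V j = {w \<in> socle p l. \<forall>i<j. \<chi> i w = 1}" for j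
  have "subgroup (V j) G \<and> infinite (restrictions H (V j))" for j
  proof (induction j)
    case 0
    have eq: "V 0 = socle p l" by (simp add: V_def)
    show ?case unfolding eq using H subgroup_socle by blast
  next
    case (Suc j)
    have eq: "V (Suc j) = {w \<in> V j. \<chi> j w = 1}"
      unfolding V_def by (auto simp: less_Suc_eq)
    obtain a where a: "\<chi> j \<in> characters G (p ^ a)" using chars by blast
    have sub: "subgroup (V j) G" using Suc by blast
    have car: "w \<in> carrier G" if "w \<in> V j" for w by (rule subgroup.mem_carrier[OF sub that])
    have "subgroup (V (Suc j)) G"
    proof (rule subgroupI)
      have "\<one> \<in> V (Suc j)"
        using subgroup.one_closed[OF sub] character_one[OF a p0] by (simp add: eq)
      then show "V (Suc j) \<noteq> {}" by blast
    qed (use sub car in \<open>auto simp: eq subgroup.m_inv_closed subgroup.m_closed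
      character_inv[OF a p0] character_mult[OF a]\<close>)
    moreover have "infinite (restrictions H (V (Suc j)))"
      unfolding eq
    proof (rule infinite_restrictions_kernel[OF p sub])
      show "infinite (restrictions H (V j))" using Suc by blast
    qed (use chars in \<open>auto simp: V_def socle_def H_def\<close>)
    ultimately show ?case by blast
  qed
  then have "infinite {\<psi> \<in> H. \<exists>w\<in>V k. \<psi> w \<noteq> 1}"
    by (intro infinite_nontrivial_if_infinite_restrictions) blast
  moreover have "{\<psi> \<in> H. \<exists>w\<in>V k. \<psi> w \<noteq> 1} \<subseteq>
    \<chi> ` {n. (\<forall>g\<in>F. \<chi> n g = 1) \<and> (\<exists>w\<in>socle p l. (\<forall>i<k. \<chi> i w = 1) \<and> \<chi> n w \<noteq> 1)}"
    unfolding H_def V_def by blast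
  ultimately show ?thesis by (meson finite_imageI finite_subset)
qed

end

section \<open>The pseudointersection number\<close>

text \<open>The cardinal is the least size of a family with infinite finite intersections and no
  pseudointersection, so a strictly smaller family with the first property must fail the
  second.\<close>

lemma pseudointersection_exists:
  fixes \<F> :: "nat set set"
  assumes card: "|\<F>| <o pseudointersection_number"
    and inf: "\<And>\<E>. finite \<E> \<Longrightarrow> \<E> \<subseteq> \<F> \<Longrightarrow> infinite (\<Inter>\<E>)"
  shows "\<exists>A. infinite A \<and> (\<forall>B\<in>\<F>. finite (A - B))"
proof (rule ccontr)
  assume neg: "\<not> ?thesis"
  have "infinite B" if "B \<in> \<F>" for B using inf[of "{B}"] that by simp
  then have "no_pseudointersection_family \<F>"
    unfolding no_pseudointersection_family_def using inf neg by (auto simp: set_diff_eq)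
  moreover have "min_no_pseudointersection_family (SOME \<F>. min_no_pseudointersection_family \<F>)"
    using ex_min_no_pseudointersection_family by (rule someI_ex)
  ultimately have "pseudointersection_number \<le>o |\<F>|"
    unfolding pseudointersection_number_def min_no_pseudointersection_family_def by blast
  then show False using card not_ordLess_ordLeq by blast
qed

section \<open>An injective endomorphism that is not surjective\<close>

lemma exists_primitive_root_of_unity:
  assumes n: "n > 0"
  shows "\<exists>\<omega>::complex. (\<forall>z. z ^ n = 1 \<longrightarrow> (\<exists>j::nat. z = \<omega> ^ j)) \<and> (\<forall>k. \<omega> ^ k = 1 \<longleftrightarrow> n dvd k)"
proof -
  define \<omega> where "\<omega> = cis (2 * pi / real n)"
  have pow: "cis (2 * pi * real k / real n) = \<omega> ^ k" for k
    by (simp add: \<omega>_def DeMoivre mult_ac)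
  have bij: "bij_betw (\<lambda>k. \<omega> ^ k) {..<n} {z. z ^ n = 1}"
    using bij_betw_roots_unity[OF n] by (simp add: pow)
  have root: "\<omega> ^ n = 1" using n by (simp add: \<omega>_def DeMoivre)
  have "n dvd k" if "\<omega> ^ k = 1" for k
  proof -
    have "\<omega> ^ k = \<omega> ^ (n * (k div n) + k mod n)" by simp
    also have "\<dots> = \<omega> ^ (k mod n)" using root by (simp only: power_add power_mult) simp
    finally have "\<omega> ^ (k mod n) = \<omega> ^ 0" using that by simp
    then have "k mod n = 0"
      using bij n unfolding bij_betw_def inj_on_def by simp
    then show ?thesis by blast
  qed
  moreover have "\<omega> ^ k = 1" if "n dvd k" for k
    using that root by (auto simp: power_mult)
  moreover have "\<exists>j. z = \<omega> ^ j" if "z ^ n = 1" for z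
    using bij that unfolding bij_betw_def by blast
  ultimately show ?thesis by blast
qed

section \<open>Endomorphisms built from characters and divisible socle elements\<close>

context comm_group
begin

text \<open>Compose \<open>\<chi>\<close> with the map sending a primitive root
  \<open>\<omega>\<close> to \<open>y\<close>, where \<open>y [^] (p ^ l) = t\<close>. The order of
  \<open>y\<close> divides \<open>p ^ Suc l\<close>, the exponent of \<open>\<chi>\<close>. On an
  element killed by \<open>p\<close> the value of \<open>\<chi>\<close> is a \<open>p\<close>-th
  root of unity, hence a power of \<open>\<omega> ^ (p ^ l)\<close>, which goes to a power of
  \<open>t\<close>.\<close>

lemma exists_endomorphism_through_character:
  assumes p: "Factorial_Ring.prime (p::nat)" and \<chi>: "\<chi> \<in> characters G (p ^ Suc l)"
    and t: "t \<in> socle p l"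
  shows "\<exists>\<theta> \<in> hom G G.
    (\<forall>x \<in> carrier G. \<chi> x = 1 \<longrightarrow> \<theta> x = \<one>) \<and>
    (\<forall>x \<in> carrier G. \<theta> x [^] (p ^ Suc l) = \<one>) \<and>
    (\<forall>x \<in> carrier G. x [^] p = \<one> \<longrightarrow> (\<exists>c. \<theta> x = t [^] (c::nat) \<and> (p dvd c \<longrightarrow> \<chi> x = 1)))"
proof -
  define n where "n = p ^ Suc l"
  have n0: "n > 0" using p by (simp add: n_def prime_gt_0_nat)
  have \<chi>n: "\<chi> \<in> characters G n" using \<chi> by (simp add: n_def)
  obtain y where y: "y \<in> carrier G" "t = y [^] (p ^ l)" and tp: "t [^] p = \<one>"
    using t by (auto simp: socle_def)
  have yn: "y [^] n = \<one>" using y tp by (simp add: n_def nat_pow_pow mult.commute)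
  have ynm: "y [^] (n * m) = \<one>" for m :: nat
    using y yn by (simp add: nat_pow_pow[symmetric])
  obtain \<omega> :: complex where gen: "\<And>z. z ^ n = 1 \<Longrightarrow> \<exists>j::nat. z = \<omega> ^ j"
    and prim: "\<And>k. \<omega> ^ k = 1 \<longleftrightarrow> n dvd k"
    using exists_primitive_root_of_unity[OF n0] by blast
  have \<omega>0: "\<omega> \<noteq> 0" using prim[of n] n0 by (auto simp: power_0_left)
  have le: "y [^] i = y [^] j" if "\<omega> ^ i = \<omega> ^ j" "i \<le> j" for i j :: nat
  proof -
    have "\<omega> ^ (j - i) = 1" using that \<omega>0 by (simp add: power_diff)
    then obtain m where "j - i = n * m" using prim by blast
    then have "j = i + n * m" using that by simp
    then show ?thesis using y ynm by (simp add: nat_pow_mult[symmetric])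
  qed
  have eq: "y [^] i = y [^] j" if "\<omega> ^ i = \<omega> ^ j" for i j :: nat
    using le[of i j] le[of j i] that by (metis nat_le_linear)
  \<comment> \<open>The choice of exponent is immaterial: two exponents giving the same power of
    \<open>\<omega>\<close> differ by a multiple of \<open>n\<close>, and \<open>y [^] n\<close> is
    trivial.\<close>
  define \<theta> where "\<theta> x = y [^] (SOME j::nat. \<chi> x = \<omega> ^ j)" for x
  have ex: "\<exists>j::nat. \<chi> x = \<omega> ^ j" if "x \<in> carrier G" for x
    using gen character_power_eq_one[OF \<chi>n that] by blast
  have \<theta>: "\<theta> x = y [^] j" if "\<chi> x = \<omega> ^ j" for x and j :: nat
  proof -
    have some: "\<chi> x = \<omega> ^ (SOME j::nat. \<chi> x = \<omega> ^ j)" using that by (rule someI)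
    show ?thesis unfolding \<theta>_def by (rule eq) (rule trans[OF some[symmetric] that])
  qed
  have "\<theta> \<in> hom G G"
  proof (rule homI)
    fix x x' assume x: "x \<in> carrier G" "x' \<in> carrier G"
    then obtain i j :: nat where ij: "\<chi> x = \<omega> ^ i" "\<chi> x' = \<omega> ^ j" using ex by blast
    then have "\<chi> (x \<otimes> x') = \<omega> ^ (i + j)" using x \<chi>n by (simp add: character_mult power_add)
    then show "\<theta> (x \<otimes> x') = \<theta> x \<otimes> \<theta> x'" using \<theta> ij y by (simp add: nat_pow_mult)
  qed (use y in \<open>simp add: \<theta>_def\<close>)
  moreover have "\<theta> x = \<one>" if "\<chi> x = 1" for x
    using \<theta>[of x 0] that by simp
  moreover have "\<theta> x [^] n = \<one>" if "x \<in> carrier G" for x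
    using y ynm by (simp add: \<theta>_def nat_pow_pow mult.commute[of _ n])
  moreover have "\<exists>c. \<theta> x = t [^] (c::nat) \<and> (p dvd c \<longrightarrow> \<chi> x = 1)"
    if x: "x \<in> carrier G" "x [^] p = \<one>" for x
  proof -
    obtain j :: nat where j: "\<chi> x = \<omega> ^ j" using ex x by blast
    have "\<chi> x ^ p = 1" by (rule character_power_prime_eq_one[OF \<chi>n n0 x])
    then have "n dvd j * p" using prim by (simp add: j power_mult[symmetric])
    then have "p ^ l dvd j" using p by (simp add: n_def prime_gt_0_nat mult.commute)
    then obtain c where c: "j = p ^ l * c" by blast
    have "\<theta> x = t [^] c" using \<theta>[OF j] y by (simp add: c nat_pow_pow)
    moreover have "\<chi> x = 1" if "p dvd c"
    proof -
      have "n dvd j" using that by (auto simp: c n_def)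
      then show ?thesis using prim j by simp
    qed
    ultimately show ?thesis by blast
  qed
  ultimately show ?thesis unfolding n_def by blast
qed

lemma character_finprod:
  assumes \<chi>: "\<chi> \<in> characters G n" "n > 0" and A: "finite A" "f \<in> A \<rightarrow> carrier G"
  shows "\<chi> (finprod G f A) = (\<Prod>i\<in>A. \<chi> (f i))"
  using A
proof (induction A rule: finite_induct)
  case empty
  then show ?case using character_one[OF \<chi>] by simp
next
  case (insert a A)
  then have "f \<in> A \<rightarrow> carrier G" "f a \<in> carrier G" by auto
  then show ?case using insert character_mult[OF \<chi>(1)] by simp
qed

lemma finprod_prime_power_torsion:
  assumes "finite A" "f \<in> A \<rightarrow> carrier G" "\<And>i. i \<in> A \<Longrightarrow> \<exists>m. f i [^] ((p::nat) ^ m) = \<one>"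
  shows "\<exists>m. finprod G f A [^] (p ^ m) = \<one>"
  using assms
proof (induction A rule: finite_induct)
  case empty
  then show ?case by simp
next
  case (insert a A)
  then have f: "f \<in> A \<rightarrow> carrier G" "f a \<in> carrier G" by auto
  obtain m where m: "f a [^] (p ^ m) = \<one>" using insert.prems by blast
  obtain k where k: "finprod G f A [^] (p ^ k) = \<one>" using insert f by blast
  have "f a [^] (p ^ (m + k)) = \<one>"
    using m f by (simp add: power_add nat_pow_pow[symmetric])
  moreover have "finprod G f A [^] (p ^ (m + k)) = \<one>"
    using k f by (simp add: power_add mult.commute[of "p ^ m"] nat_pow_pow[symmetric])
  ultimately have "(f a \<otimes> finprod G f A) [^] (p ^ (m + k)) = \<one>"
    using f by (simp add: nat_pow_distrib)
  then show ?case using insert f by auto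
qed

text \<open>With \<open>\<theta>\<^sub>k\<close> sending the values of \<open>\<xi>\<^sub>k\<close> to powers of a \<open>p\<^sup>l\<close>-th root of \<open>t\<^sub>k\<close>, the map
  \<open>f g = g \<otimes> \<Prod>\<^sub>k \<theta>\<^sub>k g\<close> acts on the \<open>t\<^sub>k\<close> like the identity plus a shift: it is injective
  but \<open>t\<^sub>0\<close> is not in its image.\<close>

theorem not_co_Hopfian_if_shift_sequence:
  fixes \<xi> :: "nat \<Rightarrow> 'a \<Rightarrow> complex" and t :: "nat \<Rightarrow> 'a" and l :: "nat \<Rightarrow> nat"
  assumes p: "Factorial_Ring.prime (p::nat)"
    and \<xi>: "\<And>k. \<xi> k \<in> characters G (p ^ Suc (l k))"
    and t: "\<And>k. t k \<in> socle p (l k)"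
    and nontriv: "\<And>k. \<xi> (Suc k) (t k) \<noteq> 1"
    and triv: "\<And>j k. j \<noteq> Suc k \<Longrightarrow> \<xi> j (t k) = 1"
    and fin: "\<And>g. g \<in> carrier G \<Longrightarrow> \<exists>K. \<forall>k\<ge>K. \<xi> k g = 1"
  shows "\<not> co_Hopfian G"
proof -
  have pk: "p ^ k > 0" for k using p by (simp add: prime_gt_0_nat)
  have tc: "t k \<in> carrier G" "t k [^] p = \<one>" for k using t[of k] by (simp_all add: socle_def)
  have "\<exists>\<theta>. \<forall>k. \<theta> k \<in> hom G G \<and>
    (\<forall>x \<in> carrier G. \<xi> k x = 1 \<longrightarrow> \<theta> k x = \<one>) \<and>
    (\<forall>x \<in> carrier G. \<theta> k x [^] (p ^ Suc (l k)) = \<one>) \<and>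
    (\<forall>x \<in> carrier G. x [^] p = \<one> \<longrightarrow> (\<exists>c. \<theta> k x = t k [^] (c::nat) \<and> (p dvd c \<longrightarrow> \<xi> k x = 1)))"
    by (rule choice) (use exists_endomorphism_through_character[OF p \<xi> t] in blast)
  then obtain \<theta> where hom: "\<And>k. \<theta> k \<in> hom G G"
    and \<theta>1: "\<And>k x. x \<in> carrier G \<Longrightarrow> \<xi> k x = 1 \<Longrightarrow> \<theta> k x = \<one>"
    and \<theta>tor: "\<And>k x. x \<in> carrier G \<Longrightarrow> \<theta> k x [^] (p ^ Suc (l k)) = \<one>"
    and \<theta>t: "\<And>k x. x \<in> carrier G \<Longrightarrow> x [^] p = \<one> \<Longrightarrow>
      \<exists>c. \<theta> k x = t k [^] (c::nat) \<and> (p dvd c \<longrightarrow> \<xi> k x = 1)"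
    by blast
  have \<theta>c: "\<theta> k x \<in> carrier G" if "x \<in> carrier G" for k x
    using hom that by (auto simp: hom_def)
  \<comment> \<open>\<open>\<theta> k g\<close> is trivial whenever \<open>\<xi> k g = 1\<close>, so
    this infinite product has finite support at every \<open>g\<close>.\<close>
  define h where "h g = gfinprod G (\<lambda>k. \<theta> k g) UNIV" for g
  have supp: "finite {k \<in> UNIV. \<theta> k g \<noteq> \<one>}" if g: "g \<in> carrier G" for g
  proof -
    obtain K where "\<forall>k\<ge>K. \<xi> k g = 1" using fin[OF g] by blast
    then have "{k \<in> UNIV. \<theta> k g \<noteq> \<one>} \<subseteq> {..<K}" using \<theta>1[OF g] by (auto simp: not_le[symmetric])
    then show ?thesis using finite_subset by blast
  qed
  have hc: "h g \<in> carrier G" if "g \<in> carrier G" for g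
    unfolding h_def using \<theta>c that by (intro gfinprod_closed) auto
  have h_eq: "h g = finprod G (\<lambda>k. \<theta> k g) {..<K}"
    if g: "g \<in> carrier G" and K: "\<And>k. k \<ge> K \<Longrightarrow> \<xi> k g = 1" for g K
  proof -
    have "h g = gfinprod G (\<lambda>k. \<theta> k g) {..<K}"
      unfolding h_def using \<theta>1 \<theta>c g K
      by (intro gfinprod_mono_neutral_cong_right) (auto simp: not_less)
    then show ?thesis using \<theta>c g by simp
  qed
  have h_mult: "h (g \<otimes> g') = h g \<otimes> h g'" if g: "g \<in> carrier G" "g' \<in> carrier G" for g g'
  proof -
    have "h (g \<otimes> g') = gfinprod G (\<lambda>k. \<theta> k g \<otimes> \<theta> k g') UNIV"
      unfolding h_def using hom g by (simp add: hom_def)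
    also have "\<dots> = h g \<otimes> h g'"
      unfolding h_def using supp g \<theta>c by (intro gfinprod_distrib) auto
    finally show ?thesis .
  qed
  define f where "f g = g \<otimes> h g" for g
  have fhom: "f \<in> hom G G"
    by (rule homI) (auto simp: f_def hc h_mult m_ac)
  interpret f: group_hom G G f
    by unfold_locales (rule fhom)
  have h_tor: "\<exists>m. h g [^] (p ^ m) = \<one>" if g: "g \<in> carrier G" for g
  proof -
    obtain K where "\<And>k. k \<ge> K \<Longrightarrow> \<xi> k g = 1" using fin[OF g] by blast
    then have "h g = finprod G (\<lambda>k. \<theta> k g) {..<K}" using g by (intro h_eq)
    moreover have "\<exists>m. finprod G (\<lambda>k. \<theta> k g) {..<K} [^] (p ^ m) = \<one>"
      using \<theta>tor[OF g] \<theta>c[OF g] by (intro finprod_prime_power_torsion) blast+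
    ultimately show ?thesis by simp
  qed
  \<comment> \<open>On elements killed by \<open>p\<close>, each \<open>\<theta> k v\<close> is a
    power of \<open>t k\<close>, and \<open>\<xi> (Suc i)\<close> sees only \<open>t i\<close>. So
    \<open>h\<close> shifts the characters by one place, and \<open>\<xi> 0\<close> sees
    nothing.\<close>
  have \<xi>h: "\<xi> 0 (h v) = 1" "\<xi> (Suc i) (h v) = 1 \<longleftrightarrow> \<xi> i v = 1"
    if v: "v \<in> carrier G" "v [^] p = \<one>" for v i
  proof -
    obtain K0 where K0: "\<forall>k\<ge>K0. \<xi> k v = 1" using fin v by blast
    \<comment> \<open>\<open>Suc i\<close> keeps the factor of index \<open>i\<close> inside the
      finite product.\<close>
    define K where "K = max K0 (Suc i)"
    have K: "\<xi> k v = 1" if "k \<ge> K" for k using K0 that by (simp add: K_def)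
    obtain c where c: "\<And>k. \<theta> k v = t k [^] (c k :: nat)" "\<And>k. p dvd c k \<Longrightarrow> \<xi> k v = 1"
      using \<theta>t[OF v] by metis
    have prod: "\<xi> j (h v) = (\<Prod>k<K. \<xi> j (t k) ^ c k)" for j
    proof -
      have "h v = finprod G (\<lambda>k. \<theta> k v) {..<K}" using v(1) K by (rule h_eq)
      then have "\<xi> j (h v) = \<xi> j (finprod G (\<lambda>k. \<theta> k v) {..<K})" by simp
      also have "\<dots> = (\<Prod>k<K. \<xi> j (\<theta> k v))"
        using v \<theta>c by (intro character_finprod[OF \<xi> pk]) auto
      also have "\<dots> = (\<Prod>k<K. \<xi> j (t k) ^ c k)"
        unfolding c(1) by (intro prod.cong refl character_nat_pow[OF \<xi> pk] tc)
      finally show ?thesis .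
    qed
    show "\<xi> 0 (h v) = 1" unfolding prod by (simp add: triv)
    have "\<xi> (Suc i) (h v) = (\<Prod>k<K. if k = i then \<xi> (Suc i) (t i) ^ c i else 1)"
      unfolding prod by (intro prod.cong) (auto simp: triv)
    also have "\<dots> = \<xi> (Suc i) (t i) ^ c i"
      by (simp add: K_def)
    finally have "\<xi> (Suc i) (h v) = \<xi> (Suc i) (t i) ^ c i" .
    moreover have "\<xi> (Suc i) (t i) ^ c i = 1 \<longleftrightarrow> p dvd c i"
      by (intro prime_root_power_eq_one_iff[OF p] nontriv character_power_prime_eq_one[OF \<xi> pk] tc)
    moreover have "p dvd c i" if "\<xi> i v = 1"
    proof -
      have "t i [^] c i = \<one>" using \<theta>1[OF v(1) that] c(1) by simp
      then have "\<xi> (Suc i) (t i) ^ c i = 1"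
        using character_nat_pow[OF \<xi> pk tc(1)] character_one[OF \<xi> pk] by metis
      then show ?thesis using calculation(2) by blast
    qed
    ultimately show "\<xi> (Suc i) (h v) = 1 \<longleftrightarrow> \<xi> i v = 1" using c(2)[of i] by auto
  qed
  have \<xi>f: "\<xi> j (f v) = \<xi> j v * \<xi> j (h v)" if "v \<in> carrier G" for j v
    unfolding f_def using that hc by (intro character_mult[OF \<xi>])
  \<comment> \<open>Triviality starts at \<open>\<xi> 0\<close> and climbs along the shift. Once all
    characters are trivial at \<open>v\<close>, \<open>h v\<close> is the empty product and
    \<open>f v = v\<close>.\<close>
  have inj_socle: "v = \<one>" if v: "v \<in> carrier G" "v [^] p = \<one>" and fv: "f v = \<one>" for v
  proof -
    have *: "\<xi> j v * \<xi> j (h v) = 1" for j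
      using \<xi>f[OF v(1), of j] character_one[OF \<xi> pk] by (simp add: fv)
    have "\<xi> j v = 1" for j
    proof (induction j)
      case 0
      then show ?case using *[of 0] \<xi>h(1)[OF v] by simp
    next
      case (Suc j)
      then show ?case using *[of "Suc j"] \<xi>h(2)[OF v, of j] by simp
    qed
    then have "h v = finprod G (\<lambda>k. \<theta> k v) {..<0}" using v by (intro h_eq)
    then show ?thesis using fv v by (simp add: f_def)
  qed
  \<comment> \<open>A kernel element equals \<open>inv (h g)\<close>, so it has
    \<open>p\<close>-power order; the last nontrivial term \<open>s\<close> among its iterated
    \<open>p\<close>-th powers would be a kernel element of order \<open>p\<close>.\<close>
  have inj: "g = \<one>" if g: "g \<in> carrier G" and fg: "f g = \<one>" for g
  proof (rule ccontr)
    assume ne: "g \<noteq> \<one>"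
    obtain m where m: "h g [^] (p ^ m) = \<one>" using h_tor[OF g] by blast
    have "g = inv (h g)" using fg g hc unfolding f_def by (metis inv_equality)
    then have gm: "g [^] (p ^ m) = \<one>" using m hc[OF g] by (metis inv_one nat_pow_inv)
    define i where "i = (LEAST i. g [^] (p ^ i) = \<one>)"
    have i: "g [^] (p ^ i) = \<one>" unfolding i_def using gm by (rule LeastI)
    have "i \<noteq> 0"
    proof
      assume "i = 0"
      then show False using i ne g by (simp add: nat_pow_eone)
    qed
    then obtain j where j: "i = Suc j" by (cases i) auto
    define s where "s = g [^] (p ^ j)"
    have "s \<noteq> \<one>" using not_less_Least[of j "\<lambda>i. g [^] (p ^ i) = \<one>"] j by (auto simp: s_def i_def)
    moreover have "s = \<one>"
    proof (rule inj_socle)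
      show "s [^] p = \<one>" using i g by (simp add: s_def j nat_pow_pow mult.commute)
      show "f s = \<one>" using g fg by (simp add: s_def f.hom_nat_pow)
    qed (simp add: s_def g)
    ultimately show False by blast
  qed
  have "inj_on f (carrier G)"
    using inj f.inj_on_one_iff by blast
  then have "f \<in> mon G G" using fhom by (simp add: mon_def)
  \<comment> \<open>A preimage \<open>v\<close> is killed by \<open>p\<close>, by injectivity. It is
    trivial under \<open>\<xi> 0\<close> and nontrivial under \<open>\<xi> (Suc 0)\<close>, and the
    shift keeps it nontrivial under every later character, against point-finiteness.\<close>
  moreover have "t 0 \<notin> f ` carrier G"
  proof
    assume "t 0 \<in> f ` carrier G"
    then obtain v where v: "v \<in> carrier G" "f v = t 0" by auto
    have "f (v [^] p) = \<one>" using v tc by (simp add: f.hom_nat_pow)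
    then have vp: "v [^] p = \<one>" using inj v by simp
    have *: "\<xi> j v * \<xi> j (h v) = \<xi> j (t 0)" for j
      using \<xi>f[OF v(1), of j] v by simp
    have "\<xi> 0 v = 1" using *[of 0] \<xi>h(1)[OF v(1) vp] triv[of 0 0] by simp
    then have "\<xi> (Suc 0) v \<noteq> 1"
      using *[of "Suc 0"] \<xi>h(2)[OF v(1) vp, of 0] nontriv[of 0] by simp
    then have "\<xi> (Suc j) v \<noteq> 1" for j
    proof (induction j)
      case (Suc j)
      then show ?case
        using *[of "Suc (Suc j)"] \<xi>h(2)[OF v(1) vp, of "Suc j"] triv[of "Suc (Suc j)" 0] by auto
    qed
    moreover obtain K where "\<forall>k\<ge>K. \<xi> k v = 1" using fin v by blast
    ultimately show False by (meson le_SucI order_refl)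
  qed
  ultimately show ?thesis
    unfolding co_Hopfian_def using tc by blast
qed

text \<open>Recursive choice along \<open>A\<close>: each new socle element is killed by all
  characters of small index, and each new index is so large that the characters in \<open>A\<close>
  from there on kill the earlier elements. Each element is then seen only by the character chosen
  with it.\<close>

lemma not_co_Hopfian_if_pseudointersection:
  fixes \<chi> :: "nat \<Rightarrow> 'a \<Rightarrow> complex" and lam lev :: "nat \<Rightarrow> nat"
  assumes p: "Factorial_Ring.prime (p::nat)"
    and mono: "mono lam"
    and chars: "\<And>n. \<chi> n \<in> characters G (p ^ Suc (lam (lev n)))"
    and A: "infinite A"
    and point: "\<And>g. g \<in> carrier G \<Longrightarrow> finite (A - {n. \<chi> n g = 1})"
    and nontriv: "\<And>k. finite (A - {n. \<exists>w\<in>socle p (lam k). (\<forall>i<k. \<chi> i w = 1) \<and> \<chi> n w \<noteq> 1})"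
  shows "\<not> co_Hopfian G"
proof -
  define W where "W k = {w \<in> socle p (lam k). \<forall>i<k. \<chi> i w = 1}" for k
  \<comment> \<open>\<open>Suc a\<close> includes \<open>\<chi> a\<close> itself among the
    characters to be killed; \<open>lev a\<close> makes the next socle element divisible enough to
    absorb the values of \<open>\<chi> a\<close>.\<close>
  define u where "u a = max (Suc a) (lev a)" for a
  have bound: "\<exists>b. \<forall>n\<in>A. b \<le> n \<longrightarrow> \<chi> n g = 1" if g: "g \<in> carrier G" for g
  proof -
    obtain b where "\<forall>n \<in> A - {n. \<chi> n g = 1}. n < b"
      using point[OF g] finite_nat_set_iff_bounded by blast
    then show ?thesis by (intro exI[of _ b]) (auto simp: not_le[symmetric])
  qed
  \<comment> \<open>A state consists of an index, a group element and a bound from which on the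
    characters indexed by \<open>A\<close> kill that element.\<close>
  define P where "P s \<longleftrightarrow> (case s of (a, x, b) \<Rightarrow>
    a \<in> A \<and> x \<in> carrier G \<and> (\<forall>n\<in>A. b \<le> n \<longrightarrow> \<chi> n x = 1))" for s :: "nat \<times> 'a \<times> nat"
  define Q where "Q s s' \<longleftrightarrow> (case s of (a, x, b) \<Rightarrow> case s' of (a', x', b') \<Rightarrow>
    a < a' \<and> b \<le> a' \<and> b \<le> b' \<and> x' \<in> W (u a) \<and> \<chi> a' x' \<noteq> 1)" for s s' :: "nat \<times> 'a \<times> nat"
  have "\<exists>s. \<forall>n. P (s n) \<and> Q (s n) (s (Suc n))"
  proof (rule dependent_nat_choice)
    obtain a where "a \<in> A" using A by (metis ex_in_conv finite.emptyI)
    moreover obtain b where "\<forall>n\<in>A. b \<le> n \<longrightarrow> \<chi> n \<one> = 1" using bound by blast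
    \<comment> \<open>The identity is a placeholder: the chosen elements enter the shift sequence
      from index one on.\<close>
    ultimately show "\<exists>s. P s" by (intro exI[of _ "(a, \<one>, b)"]) (simp add: P_def)
  next
    fix s :: "nat \<times> 'a \<times> nat" and n :: nat
    obtain a x b where s: "s = (a, x, b)" by (cases s)
    define D where "D = A - {n. \<exists>w\<in>socle p (lam (u a)). (\<forall>i<u a. \<chi> i w = 1) \<and> \<chi> n w \<noteq> 1}"
    have "finite (D \<union> {..a} \<union> {..b})" using nontriv by (simp add: D_def)
    then have "infinite (A - (D \<union> {..a} \<union> {..b}))" using A by (rule Diff_infinite_finite)
    then obtain a' where "a' \<in> A - (D \<union> {..a} \<union> {..b})" using infinite_imp_nonempty by blast
    then have a': "a' \<in> A" "a' \<notin> D" "a < a'" "b < a'" by auto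
    then obtain w where w: "w \<in> W (u a)" "\<chi> a' w \<noteq> 1" by (auto simp: D_def W_def)
    have wc: "w \<in> carrier G" using w by (simp add: W_def socle_def)
    obtain b' where b': "\<forall>n\<in>A. b' \<le> n \<longrightarrow> \<chi> n w = 1" using bound[OF wc] by blast
    have "P (a', w, max b b') \<and> Q s (a', w, max b b')"
      using a' w wc b' by (simp add: P_def Q_def s)
    then show "\<exists>s'. P s' \<and> Q s s'" by blast
  qed
  then obtain s where Ps: "\<And>n. P (s n)" and Qs: "\<And>n. Q (s n) (s (Suc n))" by blast
  define a where "a n = fst (s n)" for n
  define x where "x n = fst (snd (s n))" for n
  define b where "b n = snd (snd (s n))" for n
  have s: "s n = (a n, x n, b n)" for n by (simp add: a_def x_def b_def)
  have aA: "a n \<in> A" and xb: "\<And>m. m \<in> A \<Longrightarrow> b n \<le> m \<Longrightarrow> \<chi> m (x n) = 1" for n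
    using Ps[of n] by (simp_all add: P_def s)
  have Q: "a n < a (Suc n)" "b n \<le> a (Suc n)" "b n \<le> b (Suc n)" "x (Suc n) \<in> W (u (a n))"
    "\<chi> (a (Suc n)) (x (Suc n)) \<noteq> 1" for n
    using Qs[of n] by (simp_all add: Q_def s)
  have a_mono: "strict_mono a" using Q(1) by (simp add: strict_mono_Suc_iff)
  have b_mono: "b m \<le> b n" if "m \<le> n" for m n using lift_Suc_mono_le[of b, OF Q(3) that] .
  \<comment> \<open>The characters are \<open>\<chi> (a k)\<close> and the socle elements
    \<open>x (Suc k)\<close>; the offset turns pairing at equal indices into the required
    shift.\<close>
  show ?thesis
  proof (rule not_co_Hopfian_if_shift_sequence[OF p])
    show "\<chi> (a k) \<in> characters G (p ^ Suc (lam (lev (a k))))" for k by (rule chars)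
    show "x (Suc k) \<in> socle p (lam (lev (a k)))" for k
    proof -
      have "lam (lev (a k)) \<le> lam (u (a k))" using mono by (simp add: u_def monoD)
      then show ?thesis using Q(4)[of k] socle_antimono unfolding W_def by blast
    qed
    show "\<chi> (a (Suc k)) (x (Suc k)) \<noteq> 1" for k by (rule Q)
    show "\<chi> (a j) (x (Suc k)) = 1" if "j \<noteq> Suc k" for j k
    proof (cases "j \<le> k")
      case True
      then have "a j < u (a k)" using a_mono by (simp add: u_def strict_mono_less_eq less_Suc_eq_le le_max_iff_disj less_max_iff_disj)
      then show ?thesis using Q(4)[of k] by (simp add: W_def)
    next
      case False
      define i where "i = j - 1"
      have i: "j = Suc i" "Suc k \<le> i" using False \<open>j \<noteq> Suc k\<close> by (auto simp: i_def)
      then have "b (Suc k) \<le> a j" using b_mono[OF i(2)] Q(2)[of i] by simp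
      then show ?thesis using xb aA by blast
    qed
    show "\<exists>K. \<forall>k\<ge>K. \<chi> (a k) g = 1" if g: "g \<in> carrier G" for g
    proof -
      obtain c where c: "\<forall>n\<in>A. c \<le> n \<longrightarrow> \<chi> n g = 1" using bound[OF g] by blast
      have "\<chi> (a k) g = 1" if "c \<le> k" for k
        using c aA strict_mono_imp_increasing[OF a_mono, of k] that by (meson order_trans)
      then show ?thesis by blast
    qed
  qed
qed

end

section \<open>Socles of reduced groups\<close>

lemma finite_if_finite_image_and_fibers:
  assumes "finite (f ` A)" "\<And>a. a \<in> A \<Longrightarrow> finite {b \<in> A. f b = f a}"
  shows "finite A"
proof (rule ccontr)
  assume "infinite A"
  then obtain y where y: "y \<in> f ` A" "infinite (f -` {y} \<inter> A)"
    using inf_img_fin_dom'[OF assms(1)] by blast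
  then obtain a where a: "a \<in> A" "y = f a" by blast
  have "f -` {y} \<inter> A = {b \<in> A. f b = f a}" using a by auto
  then show False using y assms(2)[OF a(1)] by simp
qed

section \<open>Finiteness and heights in the p-torsion\<close>

context comm_group
begin

text \<open>Each fibre of \<open>f\<close> lies in one translate of \<open>K\<close>. This form
  covers both the \<open>p\<close>-th power map and evaluation against a family of
  characters.\<close>

lemma finite_if_finite_kernel:
  assumes A: "A \<subseteq> carrier G" and K: "finite K" and im: "finite (f ` A)"
    and eq: "\<And>a b. a \<in> A \<Longrightarrow> b \<in> A \<Longrightarrow> f b = f a \<Longrightarrow> b \<otimes> inv a \<in> K"
  shows "finite A"
proof (rule finite_if_finite_image_and_fibers[OF im])
  fix a assume a: "a \<in> A"
  have "{b \<in> A. f b = f a} \<subseteq> (\<lambda>k. k \<otimes> a) ` K"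
  proof
    fix b assume "b \<in> {b \<in> A. f b = f a}"
    then have b: "b \<in> A" "f b = f a" by auto
    have "b = (b \<otimes> inv a) \<otimes> a" using a b A by (simp add: m_assoc subset_iff)
    then show "b \<in> (\<lambda>k. k \<otimes> a) ` K" using eq[OF a b] by blast
  qed
  then show "finite {b \<in> A. f b = f a}" using K finite_surj by blast
qed

text \<open>The \<open>p\<close>-th power map lowers the exponent of torsion by one step, and its
  kernel lies in the finite socle.\<close>

lemma finite_prime_power_torsion:
  assumes fin: "finite (socle p 0)"
  shows "finite {x \<in> carrier G. x [^] ((p::nat) ^ n) = \<one>}"
proof (induction n)
  case 0
  have "{x \<in> carrier G. x [^] (p ^ 0) = \<one>} \<subseteq> {\<one>}" by (auto simp: nat_pow_eone)
  then show ?case using finite_subset by blast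
next
  case (Suc n)
  show ?case
  proof (rule finite_if_finite_kernel[OF _ fin])
    show "finite ((\<lambda>x. x [^] p) ` {x \<in> carrier G. x [^] (p ^ Suc n) = \<one>})"
      by (rule finite_subset[OF _ Suc]) (auto simp: nat_pow_pow)
  next
    fix a b assume ab: "a \<in> {x \<in> carrier G. x [^] (p ^ Suc n) = \<one>}"
      "b \<in> {x \<in> carrier G. x [^] (p ^ Suc n) = \<one>}" and eq: "b [^] p = a [^] p"
    define c where "c = b \<otimes> inv a"
    have c: "c \<in> carrier G" "c [^] p = \<one>"
      using ab eq by (simp_all add: c_def nat_pow_distrib nat_pow_inv)
    moreover have "c = c [^] (p ^ 0)" using c by (simp add: nat_pow_eone)
    ultimately show "b \<otimes> inv a \<in> socle p 0" unfolding c_def[symmetric] socle_def by blast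
  qed auto
qed

text \<open>Induction on the order of \<open>x\<close>: by hypothesis \<open>x [^] p\<close> is a
  power of very high exponent, so some highly divisible \<open>w\<close> has the same
  \<open>p\<close>-th power as \<open>x\<close>. The quotient of \<open>x\<close> by
  \<open>w\<close> lies in \<open>socle p M\<close>, where every height is attained.\<close>

lemma infinite_height_if_socle_infinite_height:
  assumes soc: "\<And>k. socle p M \<subseteq> socle p k"
  shows "\<lbrakk>x \<in> carrier G; y \<in> carrier G; x = y [^] (p ^ M); x [^] (p ^ e) = \<one>\<rbrakk> \<Longrightarrow>
    \<exists>z \<in> carrier G. x = z [^] ((p::nat) ^ k)"
proof (induction e arbitrary: x y k)
  case 0
  then have "x = \<one>" by (simp add: nat_pow_eone)
  then show ?case by (intro bexI[of _ \<one>]) auto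
next
  case (Suc e)
  \<comment> \<open>The extra \<open>Suc\<close> is spent on the \<open>p\<close>-th root
    \<open>w\<close>; the maximum makes \<open>w\<close> both a \<open>p ^ M\<close>-th power, as
    needed for the quotient to lie in \<open>socle p M\<close>, and a \<open>p ^ k\<close>-th
    power.\<close>
  have "\<exists>z \<in> carrier G. x [^] p = z [^] (p ^ (Suc (max k M)))"
  proof (rule Suc.IH)
    show "x [^] p = (y [^] p) [^] (p ^ M)" using Suc.prems by (simp add: nat_pow_pow mult.commute)
    show "(x [^] p) [^] (p ^ e) = \<one>" using Suc.prems(1,4) by (simp add: nat_pow_pow)
  qed (use Suc.prems in auto)
  then obtain z where z: "z \<in> carrier G" "x [^] p = z [^] (p ^ (Suc (max k M)))" by blast
  obtain i where i: "max k M = i + M" by (metis add.commute le_Suc_ex max.cobounded2)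
  obtain j where j: "max k M = j + k" by (metis add.commute le_Suc_ex max.cobounded1)
  define w where "w = z [^] (p ^ max k M)"
  have w: "w \<in> carrier G" "w [^] p = x [^] p"
    using z by (simp_all add: w_def nat_pow_pow mult.commute)
  have wM: "w = (z [^] (p ^ i)) [^] (p ^ M)" using z by (simp add: w_def i nat_pow_pow power_add)
  have wk: "w = (z [^] (p ^ j)) [^] (p ^ k)" using z by (simp add: w_def j nat_pow_pow power_add)
  define s where "s = x \<otimes> inv w"
  have s: "s \<in> carrier G" "s [^] p = \<one>"
    using w Suc.prems by (simp_all add: s_def nat_pow_distrib nat_pow_inv)
  have "s = (y \<otimes> inv (z [^] (p ^ i))) [^] (p ^ M)"
    unfolding s_def wM using Suc.prems z by (simp add: nat_pow_distrib nat_pow_inv)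
  moreover have "y \<otimes> inv (z [^] (p ^ i)) \<in> carrier G" using Suc.prems z by simp
  ultimately have "s \<in> socle p M" using s unfolding socle_def by blast
  then obtain u where u: "u \<in> carrier G" "s = u [^] (p ^ k)" using soc[of k] by (auto simp: socle_def)
  have "x = s \<otimes> w" using w Suc.prems by (simp add: s_def m_assoc)
  also have "\<dots> = (u \<otimes> z [^] (p ^ j)) [^] (p ^ k)"
    unfolding u wk using u z by (simp add: nat_pow_distrib)
  finally show ?case using u z by blast
qed

text \<open>The \<open>p\<close>-power torsion elements that are \<open>p ^ M\<close>-th powers form
  a divisible subgroup \<open>D\<close>: roots of \<open>p\<close>-power degree come from infinite
  height, roots of degree prime to \<open>p\<close> from Bezout. Reducedness makes \<open>D\<close>
  trivial.\<close>

lemma reduced_socle_infinite_height_trivial: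
  assumes p: "Factorial_Ring.prime (p::nat)" and red: "reduced_group G"
    and soc: "\<And>k. socle p M \<subseteq> socle p k"
    and x: "x \<in> carrier G" "x [^] (p ^ e) = \<one>" and y: "y \<in> carrier G" "x = y [^] (p ^ M)"
  shows "x = \<one>"
proof -
  define D where "D = {x \<in> carrier G. (\<exists>y\<in>carrier G. x = y [^] (p ^ M)) \<and> (\<exists>e. x [^] (p ^ e) = \<one>)}"
  have "subgroup D G"
  proof (rule subgroupI)
    have "\<one> \<in> D"
      unfolding D_def by (intro CollectI conjI bexI[of _ \<one>] exI[of _ 0]) auto
    then show "D \<noteq> {}" by blast
  next
    fix a assume "a \<in> D"
    then obtain b e where a: "a \<in> carrier G" "b \<in> carrier G" "a = b [^] (p ^ M)" "a [^] (p ^ e) = \<one>"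
      by (auto simp: D_def)
    then have "inv a = inv b [^] (p ^ M)" "inv a [^] (p ^ e) = \<one>" by (simp_all add: nat_pow_inv)
    then show "inv a \<in> D" unfolding D_def using a by blast
  next
    fix a a' assume "a \<in> D" "a' \<in> D"
    then obtain b e b' e' where a: "a \<in> carrier G" "b \<in> carrier G" "a = b [^] (p ^ M)" "a [^] (p ^ e) = \<one>"
      and a': "a' \<in> carrier G" "b' \<in> carrier G" "a' = b' [^] (p ^ M)" "a' [^] (p ^ e') = \<one>"
      by (auto simp: D_def)
    have "a [^] (p ^ (e + e')) = (a [^] (p ^ e)) [^] (p ^ e')"
      "a' [^] (p ^ (e + e')) = (a' [^] (p ^ e')) [^] (p ^ e)"
      using a(1) a'(1) by (simp_all add: nat_pow_pow power_add mult.commute)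
    then have "(a \<otimes> a') [^] (p ^ (e + e')) = \<one>" using a a' by (simp add: nat_pow_distrib)
    moreover have "a \<otimes> a' = (b \<otimes> b') [^] (p ^ M)" using a a' by (simp add: nat_pow_distrib)
    moreover have "a \<otimes> a' \<in> carrier G" "b \<otimes> b' \<in> carrier G" using a a' by auto
    ultimately show "a \<otimes> a' \<in> D" unfolding D_def by blast
  qed (auto simp: D_def)
  moreover have "\<exists>b\<in>D. b [^] n = a" if n: "n > 0" and aD: "a \<in> D" for n :: nat and a
  proof -
    obtain e c where a: "a \<in> carrier G" "a [^] (p ^ e) = \<one>" and c: "c \<in> carrier G" "a = c [^] (p ^ M)"
      using aD by (auto simp: D_def)
    obtain r m where rm: "n = p ^ r * m" "\<not> p dvd m"
    proof (rule multiplicity_decompose')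
      show "n \<noteq> 0" "\<not> is_unit p" using n p by auto
    qed
    \<comment> \<open>Exponent \<open>M + r\<close> rather than \<open>r\<close>, so that the
      \<open>p ^ r\<close>-th root \<open>b\<close> is still a \<open>p ^ M\<close>-th power and
      stays in \<open>D\<close>.\<close>
    obtain z where z: "z \<in> carrier G" "a = z [^] (p ^ (M + r))"
      using infinite_height_if_socle_infinite_height[OF soc a(1) c a(2)] by blast
    define b where "b = z [^] (p ^ M)"
    have b: "b \<in> carrier G" "b [^] (p ^ r) = a"
      using z by (simp_all add: b_def nat_pow_pow power_add)
    have btor: "b [^] (p ^ (r + e)) = \<one>"
      using b a by (simp add: power_add nat_pow_pow[symmetric])
    \<comment> \<open>On the powers of \<open>b\<close>, an element of \<open>p\<close>-power order,
      raising to the \<open>m\<close> is invertible; \<open>u\<close> is the inverse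
      exponent.\<close>
    have "coprime m (p ^ (r + e))"
      using rm p by (metis coprime_commute coprime_power_right_iff prime_imp_coprime)
    moreover have "m \<noteq> 0" using rm by (metis dvd_0_right)
    ultimately obtain u v where uv: "m * u = p ^ (r + e) * v + 1"
      using bezout_nat[of m "p ^ (r + e)"] by auto
    have "(b [^] u) [^] n = (b [^] (m * u)) [^] (p ^ r)"
      using b by (simp add: nat_pow_pow rm mult_ac)
    also have "b [^] (m * u) = b"
      using b btor by (simp add: uv nat_pow_mult[symmetric] nat_pow_pow[symmetric])
    finally have "(b [^] u) [^] n = a" using b by simp
    moreover have "b [^] u \<in> D"
    proof -
      have "b [^] u = (z [^] u) [^] (p ^ M)"
        using z by (simp add: b_def nat_pow_pow mult.commute)
      moreover have "(b [^] u) [^] (p ^ (r + e)) = (b [^] (p ^ (r + e))) [^] u"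
        using b by (simp add: nat_pow_pow mult.commute)
      then have "(b [^] u) [^] (p ^ (r + e)) = \<one>" using btor by simp
      ultimately show ?thesis unfolding D_def using b z by blast
    qed
    ultimately show ?thesis by blast
  qed
  ultimately have "divisible_subgroup D G" by (simp add: divisible_subgroup_def)
  then have "D = {\<one>}" using red by (simp add: reduced_group_def)
  moreover have "x \<in> D" unfolding D_def using x y by blast
  ultimately show ?thesis by blast
qed

text \<open>A finite socle makes the decreasing chain of the \<open>socle p k\<close> stabilise at
  some \<open>M\<close>, a level of least cardinality. Then \<open>p ^ M\<close>-th powers of
  torsion elements are trivial, so the torsion has bounded exponent and is finite as well.\<close>

lemma infinite_socle:
  assumes p: "Factorial_Ring.prime (p::nat)" and red: "reduced_group G"
    and inf: "infinite {x \<in> carrier G. \<exists>k. x [^] (p ^ k) = \<one>}"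
  shows "infinite (socle p 0)"
proof
  assume fin: "finite (socle p 0)"
  have fin_k: "finite (socle p k)" for k
    using fin socle_antimono[of 0 k p] finite_subset by blast
  define M where "M = (ARG_MIN (\<lambda>k. card (socle p k)) k. True)"
  have M: "card (socle p M) \<le> card (socle p k)" for k
    unfolding M_def by (rule arg_min_nat_le) simp
  have "socle p M \<subseteq> socle p k" for k
  proof (cases "k \<le> M")
    case True
    then show ?thesis by (rule socle_antimono)
  next
    case False
    then have "socle p k \<subseteq> socle p M" by (intro socle_antimono) simp
    then have "socle p k = socle p M"
      using M[of k] by (intro card_seteq fin_k)
    then show ?thesis by simp
  qed
  note triv = reduced_socle_infinite_height_trivial[OF p red this]
  have "{x \<in> carrier G. \<exists>k. x [^] (p ^ k) = \<one>} \<subseteq> {x \<in> carrier G. x [^] (p ^ M) = \<one>}"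
  proof clarify
    fix x k assume x: "x \<in> carrier G" "x [^] (p ^ k) = \<one>"
    show "x [^] (p ^ M) = \<one>"
    proof (rule triv[OF _ _ x(1) refl])
      have "(x [^] (p ^ M)) [^] (p ^ k) = (x [^] (p ^ k)) [^] (p ^ M)"
        using x(1) by (simp add: nat_pow_pow mult.commute)
      then show "(x [^] (p ^ M)) [^] (p ^ k) = \<one>" using x by simp
    qed (use x in simp)
  qed
  then show False using inf finite_prime_power_torsion[OF fin] finite_subset by blast
qed

text \<open>Modulo the common kernel of \<open>H\<close>, \<open>W\<close> embeds by evaluation into
  a product of groups of \<open>p\<close>-th roots of unity, with one factor for each of the
  finitely many restrictions.\<close>

lemma finite_if_finite_restrictions:
  assumes p: "Factorial_Ring.prime (p::nat)"
    and sub: "subgroup W G" and W: "\<And>w. w \<in> W \<Longrightarrow> w [^] p = \<one>"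
    and chars: "\<And>\<chi>. \<chi> \<in> H \<Longrightarrow> \<exists>k. \<chi> \<in> characters G (p ^ k)"
    and fin: "finite (restrictions H W)" and ker: "finite {w \<in> W. \<forall>\<chi>\<in>H. \<chi> w = 1}"
  shows "finite W"
proof (rule finite_if_finite_kernel[OF _ ker])
  define R where "R = restrictions H W"
  have pk: "p ^ k > 0" for k using p by (simp add: prime_gt_0_nat)
  show WG: "W \<subseteq> carrier G" using sub by (rule subgroup.subset)
  have "(\<lambda>w. restrict (\<lambda>\<rho>. \<rho> w) R) ` W \<subseteq> (\<Pi>\<^sub>E \<rho>\<in>R. {z. z ^ p = 1})"
  proof clarify
    fix w assume w: "w \<in> W"
    show "restrict (\<lambda>\<rho>. \<rho> w) R \<in> (\<Pi>\<^sub>E \<rho>\<in>R. {z. z ^ p = 1})"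
    proof (rule restrict_PiE_iff[THEN iffD2], intro ballI CollectI)
      fix \<rho> assume "\<rho> \<in> R"
      then obtain \<chi> where \<chi>: "\<chi> \<in> H" "\<rho> = restrict \<chi> W" by (auto simp: R_def)
      obtain k where "\<chi> \<in> characters G (p ^ k)" using chars \<chi> by blast
      then have "\<chi> w ^ p = 1" using pk WG w W by (intro character_power_prime_eq_one) auto
      then show "\<rho> w ^ p = 1" using \<chi> w by simp
    qed
  qed
  moreover have "finite {z::complex. z ^ p = 1}"
    using p prime_gt_0_nat by (intro finite_roots_unity) (simp add: Suc_leI)
  then have "finite (\<Pi>\<^sub>E \<rho>\<in>R. {z::complex. z ^ p = 1})"
    using fin by (intro finite_PiE) (simp_all only: R_def)
  ultimately show "finite ((\<lambda>w. restrict (\<lambda>\<rho>. \<rho> w) R) ` W)" by (rule finite_subset)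
  fix a b assume ab: "a \<in> W" "b \<in> W" and eq: "restrict (\<lambda>\<rho>. \<rho> b) R = restrict (\<lambda>\<rho>. \<rho> a) R"
  have "\<chi> (b \<otimes> inv a) = 1" if \<chi>: "\<chi> \<in> H" for \<chi>
  proof -
    obtain k where k: "\<chi> \<in> characters G (p ^ k)" using chars \<chi> by blast
    have "restrict \<chi> W \<in> R" using \<chi> by (simp only: R_def image_eqI)
    then have "\<chi> b = \<chi> a" using fun_cong[OF eq, of "restrict \<chi> W"] ab by simp
    moreover have "\<chi> a \<noteq> 0" using character_nonzero[OF k pk] ab WG by blast
    ultimately show ?thesis
      using character_mult[OF k, of b "inv a"] character_inv[OF k pk, of a] ab WG
      by (simp add: subset_iff)
  qed
  moreover have "b \<otimes> inv a \<in> W" using sub ab by (simp add: subgroup.m_closed subgroup.m_inv_closed)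
  ultimately show "b \<otimes> inv a \<in> {w \<in> W. \<forall>\<chi>\<in>H. \<chi> w = 1}" by blast
qed

text \<open>Otherwise some character of exponent \<open>p ^ k\<close> would separate
  \<open>w\<close> from the identity. Characters thus recover the height filtration of the
  socle.\<close>

lemma mem_socle_if_characters_trivial:
  assumes p: "Factorial_Ring.prime (p::nat)" and w: "w \<in> socle p 0"
    and triv: "\<And>\<chi>. \<chi> \<in> characters G (p ^ k) \<Longrightarrow> \<chi> w = 1"
  shows "w \<in> socle p k"
proof (rule ccontr)
  have w': "w \<in> carrier G" "w [^] p = \<one>" using w by (simp_all add: socle_def)
  assume "w \<notin> socle p k"
  then have "w \<noteq> y [^] (p ^ k)" if "y \<in> carrier G" for y
    using that w' by (auto simp: socle_def)
  then show False using exists_separating_character[OF p w', of k] triv by blast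
qed

text \<open>Constant \<open>lam\<close> serves the case of an infinite Ulm--Kaplansky invariant, the identity the
  case that all of them are finite.\<close>

lemma exists_levels_with_infinite_restrictions:
  assumes p: "Factorial_Ring.prime (p::nat)" and red: "reduced_group G"
    and inf: "infinite {x \<in> carrier G. \<exists>k. x [^] (p ^ k) = \<one>}"
  shows "\<exists>lam :: nat \<Rightarrow> nat. mono lam \<and>
    (\<forall>k. infinite (restrictions (\<Union>j. characters G (p ^ Suc (lam j))) (socle p (lam k))))"
proof (cases "\<exists>l. infinite (restrictions (characters G (p ^ Suc l)) (socle p l))")
  case True
  then obtain l where l: "infinite (restrictions (characters G (p ^ Suc l)) (socle p l))" by blast
  have eq: "(\<Union>j::nat. characters G (p ^ Suc l)) = characters G (p ^ Suc l)" by simp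
  show ?thesis
  proof (intro exI[of _ "\<lambda>_. l"] conjI allI)
    show "mono (\<lambda>_::nat. l)" by (simp add: mono_def)
    show "infinite (restrictions (\<Union>j::nat. characters G (p ^ Suc l)) (socle p l))"
      unfolding eq by (rule l)
  qed
next
  case False
  have pk: "p ^ k > 0" for k using p by (simp add: prime_gt_0_nat)
  have soc_p: "w [^] p = \<one>" if "w \<in> socle p l" for w l using that by (simp add: socle_def)
  have soc_0: "w \<in> socle p 0" if "w \<in> socle p l" for w l using that socle_antimono[of 0 l p] by blast
  \<comment> \<open>With only finitely many restrictions at each level,
    \<open>socle p (Suc l)\<close> has finite index in \<open>socle p l\<close>, so infiniteness
    passes down the filtration.\<close>
  have inf_soc: "infinite (socle p l)" for l
  proof (induction l)
    case 0
    show ?case by (rule infinite_socle[OF p red inf])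
  next
    case (Suc l)
    show ?case
    proof
      assume fin: "finite (socle p (Suc l))"
      have "{w \<in> socle p l. \<forall>\<chi>\<in>characters G (p ^ Suc l). \<chi> w = 1} \<subseteq> socle p (Suc l)"
        using mem_socle_if_characters_trivial[OF p soc_0] by blast
      then have "finite {w \<in> socle p l. \<forall>\<chi>\<in>characters G (p ^ Suc l). \<chi> w = 1}"
        using fin finite_subset by blast
      moreover have "finite (restrictions (characters G (p ^ Suc l)) (socle p l))" using False by blast
      ultimately have "finite (socle p l)"
        by (intro finite_if_finite_restrictions[OF p subgroup_socle soc_p, where H = "characters G (p ^ Suc l)"]) blast+
      then show False using Suc by blast
    qed
  qed
  define H where "H = (\<Union>j. characters G (p ^ Suc j))"
  have "infinite (restrictions H (socle p l))" for l
  proof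
    assume "finite (restrictions H (socle p l))"
    then obtain Y where Y: "Y \<subseteq> H" "finite Y" "restrictions H (socle p l) = restrictions Y (socle p l)"
      using finite_subset_image[of "restrictions H (socle p l)" "\<lambda>\<chi>. restrict \<chi> (socle p l)" H] by blast
    have "\<forall>\<chi>\<in>Y. \<exists>j. \<chi> \<in> characters G (p ^ Suc j)" using Y by (auto simp: H_def)
    then obtain j where j: "\<And>\<chi>. \<chi> \<in> Y \<Longrightarrow> \<chi> \<in> characters G (p ^ Suc (j \<chi>))" by metis
    \<comment> \<open>\<open>p ^ M\<close> is an exponent for all of the finitely many
      representatives \<open>Y\<close>, which are thus trivial on \<open>socle p M\<close>. As
      \<open>l \<le> M\<close>, so is all of \<open>H\<close>; then \<open>socle p M\<close> has
      infinite height and is trivial by reducedness.\<close>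
    define M where "M = Suc (Max (insert l (j ` Y)))"
    have lM: "l \<le> M" using Y by (simp add: M_def le_SucI)
    have jM: "Suc (j \<chi>) \<le> M" if "\<chi> \<in> Y" for \<chi> using Y that by (simp add: M_def)
    have triv: "\<chi> w = 1" if \<chi>: "\<chi> \<in> H" and w: "w \<in> socle p M" for \<chi> w
    proof -
      have wl: "w \<in> socle p l" using socle_antimono[OF lM] w by blast
      obtain \<psi> where \<psi>: "\<psi> \<in> Y" "restrict \<chi> (socle p l) = restrict \<psi> (socle p l)"
        using Y(3) \<chi> by (metis (no_types, lifting) image_iff)
      obtain y where y: "y \<in> carrier G" "w = y [^] (p ^ M)" using w by (auto simp: socle_def)
      have "\<psi> \<in> characters G (p ^ M)"
        using j[OF \<psi>(1)] characters_mono[OF le_imp_power_dvd[OF jM[OF \<psi>(1)]]] by blast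
      then have "\<psi> w = 1"
        using y character_nat_pow[OF _ pk] character_power_eq_one by metis
      then show ?thesis using fun_cong[OF \<psi>(2), of w] wl by simp
    qed
    have "socle p M \<subseteq> socle p k" for k
    proof
      fix w assume w: "w \<in> socle p M"
      \<comment> \<open>\<open>H\<close> collects the exponents \<open>p ^ Suc j\<close> only, hence
        the detour through \<open>Suc k\<close>.\<close>
      have "w \<in> socle p (Suc k)"
        by (rule mem_socle_if_characters_trivial[OF p soc_0[OF w]])
          (rule triv[OF _ w], auto simp: H_def)
      then show "w \<in> socle p k" using socle_antimono[of k "Suc k" p] by auto
    qed
    note hgt = reduced_socle_infinite_height_trivial[OF p red this]
    have "socle p M \<subseteq> {\<one>}"
    proof
      fix w assume "w \<in> socle p M"
      then obtain y where "w \<in> carrier G" "w [^] p = \<one>" "y \<in> carrier G" "w = y [^] (p ^ M)"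
        by (auto simp: socle_def)
      then show "w \<in> {\<one>}" using hgt[of w 1 y] by simp
    qed
    then show False using inf_soc[of M] finite_subset by blast
  qed
  then show ?thesis unfolding H_def
    by (intro exI[of _ "\<lambda>k. k"] conjI allI) (simp add: mono_def)
qed

end

section \<open>Countable families of characters\<close>

text \<open>Apply the operation to all pairs and parameters, and iterate through the natural
  numbers. \<open>neutral\<close> makes the stages increasing, so any two elements of the union meet
  in one stage.\<close>

lemma exists_countable_closed_subset:
  fixes op :: "'b \<Rightarrow> 'b \<Rightarrow> 'c::countable \<Rightarrow> 'b"
  assumes Y: "countable Y" "Y \<subseteq> H"
    and closed: "\<And>a b d. a \<in> H \<Longrightarrow> b \<in> H \<Longrightarrow> op a b d \<in> H"
    and neutral: "\<And>a b. \<exists>d. op a b d = a"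
  shows "\<exists>Z. countable Z \<and> Y \<subseteq> Z \<and> Z \<subseteq> H \<and> (\<forall>a\<in>Z. \<forall>b\<in>Z. \<forall>d. op a b d \<in> Z)"
proof -
  define F where "F Z = (\<lambda>(a, b, d). op a b d) ` (Z \<times> Z \<times> UNIV)" for Z
  define Zn where "Zn n = (F ^^ n) Y" for n
  have F: "op a b d \<in> F Z" if "a \<in> Z" "b \<in> Z" for a b d Z
    unfolding F_def using that by force
  have Zn: "Zn 0 = Y" "\<And>n. Zn (Suc n) = F (Zn n)" by (simp_all add: Zn_def)
  have countH: "countable (Zn n) \<and> Zn n \<subseteq> H" for n
  proof (induction n)
    case 0
    then show ?case using Y by (simp add: Zn)
  next
    case (Suc n)
    then show ?case using closed by (auto simp: Zn F_def)
  qed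
  have "Zn n \<subseteq> Zn (Suc n)" for n
    using F neutral unfolding Zn by (metis subsetI)
  then have inc: "Zn m \<subseteq> Zn n" if "m \<le> n" for m n
    using that by (rule lift_Suc_mono_le)
  have "op a b d \<in> (\<Union>n. Zn n)" if ab: "a \<in> (\<Union>n. Zn n)" "b \<in> (\<Union>n. Zn n)" for a b d
  proof -
    obtain m n where "a \<in> Zn m" "b \<in> Zn n" using ab by blast
    then have "a \<in> Zn (max m n)" "b \<in> Zn (max m n)" using inc by (meson max.cobounded1 max.cobounded2 subsetD)+
    then have "op a b d \<in> Zn (Suc (max m n))" unfolding Zn by (rule F)
    then show ?thesis by blast
  qed
  moreover have "Y \<subseteq> (\<Union>n. Zn n)" using Zn(1) by blast
  moreover have "countable (\<Union>n. Zn n)" "(\<Union>n. Zn n) \<subseteq> H" using countH by auto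
  ultimately show ?thesis by (intro exI[of _ "\<Union>n. Zn n"] conjI ballI allI)
qed

text \<open>For each \<open>k\<close> countably many members already have infinitely many
  restrictions to \<open>W k\<close>; collect these and close off. Indexing by natural numbers turns
  sets of characters into sets of naturals, to which the pseudointersection number applies.\<close>

lemma exists_enumeration_of_closed_family:
  fixes H :: "('a \<Rightarrow> complex) set" and W :: "nat \<Rightarrow> 'a set"
  assumes closed: "\<And>\<chi> \<psi> d. \<chi> \<in> H \<Longrightarrow> \<psi> \<in> H \<Longrightarrow> (\<lambda>x. \<chi> x * \<psi> x ^ (d::nat)) \<in> H"
    and inf: "\<And>k. infinite (restrictions H (W k))"
  shows "\<exists>\<chi> :: nat \<Rightarrow> 'a \<Rightarrow> complex. range \<chi> \<subseteq> H \<and>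
    (\<forall>m n d. (\<lambda>x. \<chi> m x * \<chi> n x ^ (d::nat)) \<in> range \<chi>) \<and>
    (\<forall>k. infinite (restrictions (range \<chi>) (W k)))"
proof -
  have "\<exists>Y \<subseteq> H. countable Y \<and> infinite (restrictions Y (W k))" for k
  proof -
    obtain C where C: "C \<subseteq> restrictions H (W k)" "countable C" "infinite C"
      using infinite_countable_subset'[OF inf] by blast
    then show ?thesis using countable_subset_image by metis
  qed
  then obtain Y where Y: "\<And>k. Y k \<subseteq> H" "\<And>k. countable (Y k)" "\<And>k. infinite (restrictions (Y k) (W k))"
    by metis
  have "\<exists>Z. countable Z \<and> (\<Union>k. Y k) \<subseteq> Z \<and> Z \<subseteq> H \<and>
    (\<forall>\<chi>\<in>Z. \<forall>\<psi>\<in>Z. \<forall>d::nat. (\<lambda>x. \<chi> x * \<psi> x ^ d) \<in> Z)"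
  proof (rule exists_countable_closed_subset)
    show "\<exists>d::nat. (\<lambda>x. \<chi> x * \<psi> x ^ d) = \<chi>" for \<chi> \<psi> :: "'a \<Rightarrow> complex"
      by (rule exI[of _ 0]) simp
  qed (use Y closed in auto)
  then obtain Z where Z: "countable Z" "(\<Union>k. Y k) \<subseteq> Z" "Z \<subseteq> H"
    and Zc: "\<forall>\<chi>\<in>Z. \<forall>\<psi>\<in>Z. \<forall>d::nat. (\<lambda>x. \<chi> x * \<psi> x ^ d) \<in> Z"
    by (elim exE conjE)
  have infZ: "infinite (restrictions Z (W k))" for k
  proof -
    have "restrictions (Y k) (W k) \<subseteq> restrictions Z (W k)" using Z(2) by blast
    then show ?thesis using Y(3) finite_subset by blast
  qed
  then have "Z \<noteq> {}" by fastforce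
  define \<chi> where "\<chi> = from_nat_into Z"
  have \<chi>: "range \<chi> = Z" unfolding \<chi>_def using \<open>Z \<noteq> {}\<close> Z(1) by (rule range_from_nat_into)
  have "\<chi> n \<in> Z" for n using \<chi> by blast
  then have "\<forall>m n d. (\<lambda>x. \<chi> m x * \<chi> n x ^ (d::nat)) \<in> range \<chi>"
    unfolding \<chi> using Zc by blast
  moreover have "\<forall>k. infinite (restrictions (range \<chi>) (W k))"
    unfolding \<chi> using infZ by (rule allI)
  moreover have "range \<chi> \<subseteq> H" unfolding \<chi> by (rule Z(3))
  ultimately show ?thesis by (intro exI[of _ \<chi>] conjI)
qed

section \<open>Application of the pseudointersection number\<close>

text \<open>The sets \<open>B g\<close> ask for triviality at \<open>g\<close>, the sets
  \<open>D k\<close> for nontriviality on a deep part of the socle. Together they form a family no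
  larger than \<open>G\<close> with infinite finite intersections; a pseudointersection is
  point-finite on \<open>G\<close> and still nontrivial on every deep part.\<close>

lemma (in comm_group) not_co_Hopfian_if_infinite_torsion:
  assumes p: "Factorial_Ring.prime (p::nat)" and red: "reduced_group G"
    and inf: "infinite {x \<in> carrier G. \<exists>k. x [^] (p ^ k) = \<one>}"
    and card: "|carrier G| <o pseudointersection_number"
  shows "\<not> co_Hopfian G"
proof -
  obtain lam :: "nat \<Rightarrow> nat" where lam: "mono lam" and
    inf_lam: "\<And>k. infinite (restrictions (\<Union>j. characters G (p ^ Suc (lam j))) (socle p (lam k)))"
    using exists_levels_with_infinite_restrictions[OF p red inf] by blast
  define H where "H = (\<Union>j. characters G (p ^ Suc (lam j)))"
  have closed: "(\<lambda>x. \<chi> x * \<psi> x ^ d) \<in> H" if \<chi>\<psi>: "\<chi> \<in> H" "\<psi> \<in> H" for \<chi> \<psi> d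
  proof -
    obtain i j where ij: "\<chi> \<in> characters G (p ^ Suc (lam i))" "\<psi> \<in> characters G (p ^ Suc (lam j))"
      using \<chi>\<psi> by (auto simp: H_def)
    have "p ^ Suc (lam i) dvd p ^ Suc (lam (max i j))" "p ^ Suc (lam j) dvd p ^ Suc (lam (max i j))"
      using monoD[OF lam, of i "max i j"] monoD[OF lam, of j "max i j"]
      by (auto intro!: le_imp_power_dvd simp del: power_Suc)
    then have "\<chi> \<in> characters G (p ^ Suc (lam (max i j)))" "\<psi> \<in> characters G (p ^ Suc (lam (max i j)))"
      using ij characters_mono by blast+
    then show ?thesis unfolding H_def by (blast intro: characters_times_power)
  qed
  obtain \<chi> :: "nat \<Rightarrow> 'a \<Rightarrow> complex" where \<chi>: "range \<chi> \<subseteq> H"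
    and \<chi>_closed: "\<And>m n d. (\<lambda>x. \<chi> m x * \<chi> n x ^ (d::nat)) \<in> range \<chi>"
    and \<chi>_inf: "\<And>k. infinite (restrictions (range \<chi>) (socle p (lam k)))"
    using exists_enumeration_of_closed_family[of H "\<lambda>k. socle p (lam k)"] closed inf_lam
    unfolding H_def by blast
  have "\<forall>n. \<exists>j. \<chi> n \<in> characters G (p ^ Suc (lam j))" using \<chi> by (auto simp: H_def)
  then obtain lev where lev: "\<And>n. \<chi> n \<in> characters G (p ^ Suc (lam (lev n)))" by metis
  define B where "B g = {n. \<chi> n g = 1}" for g
  define D where "D k = {n. \<exists>w\<in>socle p (lam k). (\<forall>i<k. \<chi> i w = 1) \<and> \<chi> n w \<noteq> 1}" for k
  have D_anti: "D k \<subseteq> D l" if "l \<le> k" for k l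
  proof
    fix n assume "n \<in> D k"
    then obtain w where w: "w \<in> socle p (lam k)" "\<forall>i<k. \<chi> i w = 1" "\<chi> n w \<noteq> 1"
      by (auto simp: D_def)
    then have "w \<in> socle p (lam l)" "\<forall>i<l. \<chi> i w = 1"
      using socle_antimono[OF monoD[OF lam that]] that by auto
    then show "n \<in> D l" using w(3) by (auto simp: D_def)
  qed
  define \<F> where "\<F> = B ` carrier G \<union> range D"
  have "infinite (\<Inter>\<E>)" if \<E>: "finite \<E>" "\<E> \<subseteq> \<F>" for \<E>
  proof -
    have "finite (\<E> \<inter> B ` carrier G)" "finite (\<E> \<inter> range D)" using \<E> by auto
    then obtain F K where F: "finite F" "F \<subseteq> carrier G" "\<E> \<inter> B ` carrier G = B ` F"
      and K: "finite K" "\<E> \<inter> range D = D ` K"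
      by (metis finite_subset_image inf_le2)
    have "\<E> = (\<E> \<inter> B ` carrier G) \<union> (\<E> \<inter> range D)" using \<E>(2) by (auto simp: \<F>_def)
    then have \<E>_eq: "\<E> = B ` F \<union> D ` K" by (simp only: F(3) K(2))
    \<comment> \<open>The sets \<open>D k\<close> decrease, so one at the largest index replaces
      finitely many; the inserted \<open>0\<close> covers empty \<open>K\<close>.\<close>
    define k where "k = Max (insert 0 K)"
    have "infinite {n. (\<forall>g\<in>F. \<chi> n g = 1) \<and> (\<exists>w\<in>socle p (lam k). (\<forall>i<k. \<chi> i w = 1) \<and> \<chi> n w \<noteq> 1)}"
      using infinite_index_set[OF p _ \<chi>_closed \<chi>_inf F(1,2)] lev by blast
    moreover have "{n. (\<forall>g\<in>F. \<chi> n g = 1) \<and> (\<exists>w\<in>socle p (lam k). (\<forall>i<k. \<chi> i w = 1) \<and> \<chi> n w \<noteq> 1)} \<subseteq> \<Inter>\<E>"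
    proof
      fix n assume "n \<in> {n. (\<forall>g\<in>F. \<chi> n g = 1) \<and> (\<exists>w\<in>socle p (lam k). (\<forall>i<k. \<chi> i w = 1) \<and> \<chi> n w \<noteq> 1)}"
      then have n: "\<And>g. g \<in> F \<Longrightarrow> n \<in> B g" "n \<in> D k" by (auto simp: B_def D_def)
      have "n \<in> D i" if "i \<in> K" for i
        using n(2) D_anti[of i k] K(1) that by (auto simp: k_def)
      then show "n \<in> \<Inter>\<E>" unfolding \<E>_eq using n(1) by blast
    qed
    ultimately show ?thesis using finite_subset by blast
  qed
  moreover have "|\<F>| <o pseudointersection_number"
  proof -
    \<comment> \<open>An infinite \<open>G\<close> absorbs the countably many sets
      \<open>D k\<close> in the cardinality of \<open>\<F>\<close>.\<close>
    have infG: "infinite (carrier G)" using inf finite_subset by (metis (no_types, lifting) mem_Collect_eq subsetI)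
    have "|range D| \<le>o |UNIV :: nat set|" by (rule card_of_image)
    also have "|UNIV :: nat set| \<le>o |carrier G|" using infG infinite_iff_card_of_nat by blast
    finally have "|\<F>| \<le>o |carrier G|"
      unfolding \<F>_def using infG by (intro card_of_Un_ordLeq_infinite_Field card_of_image)
        (auto simp: Field_card_of)
    then show ?thesis using card by (rule ordLeq_ordLess_trans)
  qed
  ultimately have "\<exists>A. infinite A \<and> (\<forall>S\<in>\<F>. finite (A - S))"
    by (intro pseudointersection_exists)
  then obtain A where A: "infinite A" "\<forall>S\<in>\<F>. finite (A - S)" by (elim exE conjE)
  show ?thesis
  proof (rule not_co_Hopfian_if_pseudointersection[OF p lam lev A(1)])
    show "finite (A - {n. \<chi> n g = 1})" if "g \<in> carrier G" for g
      using bspec[OF A(2), of "B g"] that by (simp add: \<F>_def B_def)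
    show "finite (A - {n. \<exists>w\<in>socle p (lam k). (\<forall>i<k. \<chi> i w = 1) \<and> \<chi> n w \<noteq> 1})" for k
      using bspec[OF A(2), of "D k"] by (simp add: \<F>_def D_def)
  qed
qed

lemma (in group) Tor_subset: "Tor p G \<subseteq> {x \<in> carrier G. \<exists>k. x [^] (p ^ k) = \<one>}"
proof
  fix x assume "x \<in> Tor p G"
  then obtain k where k: "x \<in> carrier G" "ord x = p ^ k" by (auto simp: Tor_def)
  then have "x [^] (p ^ k) = \<one>" using pow_ord_eq_1[of x] by simp
  then show "x \<in> {x \<in> carrier G. \<exists>k. x [^] (p ^ k) = \<one>}" using k by blast
qed

theorem theorem1p1:
  shows
    "(\<forall>G :: ('a, 'b) monoid_scheme.
        comm_group G \<and> reduced_group G \<and>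
        natLeq \<le>o |carrier G| \<and> |carrier G| <o ctwo ^c natLeq \<and>
        |carrier G| <o pseudointersection_number \<and>
        (\<exists>p::nat. Factorial_Ring.prime p \<and> infinite (Tor p G))
        \<longrightarrow> \<not> co_Hopfian G)
     \<and>
     (\<forall>p::nat. Factorial_Ring.prime p \<longrightarrow>
        \<not> (\<exists>G :: ('a, 'b) monoid_scheme.
             comm_group G \<and> p_group p G \<and> reduced_group G \<and> co_Hopfian G \<and>
             natLeq \<le>o |carrier G| \<and> |carrier G| <o pseudointersection_number))"
proof -
  have main: "\<not> co_Hopfian G"
    if "comm_group G" "reduced_group G" "|carrier G| <o pseudointersection_number"
      "Factorial_Ring.prime p" "infinite (Tor p G)"
    for G :: "('a, 'b) monoid_scheme" and p :: nat
  proof -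
    interpret comm_group G by fact
    show ?thesis
      using not_co_Hopfian_if_infinite_torsion[OF that(4,2) _ that(3)] that(5) Tor_subset[of p]
        finite_subset by blast
  qed
  \<comment> \<open>A \<open>p\<close>-group is its own \<open>p\<close>-torsion part, which reduces
    the second claim to the first.\<close>
  have "infinite (Tor p G)" if "p_group p G" "natLeq \<le>o |carrier G|"
    for G :: "('a, 'b) monoid_scheme" and p :: nat
  proof -
    have "Tor p G = carrier G" using that(1) by (auto simp: Tor_def p_group_def)
    then show ?thesis using that(2) infinite_iff_natLeq_ordLeq by metis
  qed
  then show ?thesis using main by blast
qed

end
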